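(* Let $\mathcal{A}$ and $\mathcal{B}$ be two classes of objects of an abelian category $\mathcal{C}$, and let $n\ge 2$ be an integer. Consider the following conditions. (a) $(\mathcal{A},\mathcal{B})$ is an $n$-cotorsion pair in $\mathcal{C}$ and $\mathcal{B}$ is a coresolving class. (b) $(\mathcal{A},\mathcal{B})$ is an $n$-cotorsion pair in $\mathcal{C}$ and $\mathcal{A}$ is a resolving class. (c) $(\mathcal{A},\mathcal{B})$ is a hereditary complete cotorsion pair in $\mathcal{C}$. Then conditions (a) and (b) are equivalent, and any of them implies (c). If in addition $\mathcal{C}$ has enough projectives or enough injectives, then (c) also implies (a) and (b).
   Context: $\mathrm{Ext}^i_{\mathcal{C}}$ is Yoneda Ext; $\mathrm{Ext}^i_{\mathcal{C}}(\mathcal{A},\mathcal{B})=0$ means $\mathrm{Ext}^i_{\mathcal{C}}(A,B)=0$ for all $A\in\mathcal{A}$, $B\in\mathcal{B}$. ${}^{\perp_1}\mathcal{B}=\{X:\mathrm{Ext}^1_{\mathcal{C}}(X,\mathcal{B})=0\}$, $\mathcal{A}^{\perp_1}=\{Y:\mathrm{Ext}^1_{\mathcal{C}}(\mathcal{A},Y)=0\}$. $\mathcal{B}^\wedge_m$ is the class of objects $C$ with an exact sequence $0\to B_m\to\cdots\to B_0\to C\to0$ of length at most $m$ with terms in $\mathcal{B}$; dually $\mathcal{A}^\vee_m$ is the class of objects $C$ with an exact sequence $0\to C\to A_0\to\cdots\to A_m\to 0$ of length at most $m$ with terms in $\mathcal{A}$. Left $n$-cotorsion pair $(\mathcal{A},\mathcal{B})$: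 $\mathcal{A}$ is closed under direct summands; $\mathrm{Ext}^i_{\mathcal{C}}(\mathcal{A},\mathcal{B})=0$ for $1\le i\le n$; every $C\in\mathcal{C}$ fits in a short exact sequence $0\to K\to A\to C\to0$ with $A\in\mathcal{A}$, $K\in\mathcal{B}^\wedge_{n-1}$. Right $n$-cotorsion pair: $\mathcal{B}$ is closed under direct summands; the same Ext vanishing; every $C$ fits in $0\to C\to B\to L\to 0$ with $B\in\mathcal{B}$, $L\in\mathcal{A}^\vee_{n-1}$. $n$-cotorsion pair: both left and right. A complete cotorsion pair is a pair $(\mathcal{A},\mathcal{B})$ with $\mathcal{A}={}^{\perp_1}\mathcal{B}$, $\mathcal{B}=\mathcal{A}^{\perp_1}$ such that every $C\in\mathcal{C}$ fits in short exact sequences $0\to B\to A\to C\to 0$ and $0\to C\to B'\to A'\to 0$ with $A,A'\in\mathcal{A}$, $B,B'\in\mathcal{B}$. A class is resolving if it is closed under extensions and under kernels of epimorphisms between its objects and contains all projective objects of $\mathcal{C}$; coresolving is dual. A cotorsion pair is hereditary if $\mathcal{A}$ is resolving and $\mathcal{B}$ is coresolving. *)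

theory Defs
  imports "HOL-Algebra.Group"
begin

section \<open>Abelian categories\<close>

text \<open>
  A category has a set \<open>Ob\<close> of objects and a set \<open>Arr\<close> of arrows inside two arbitrary types.
  \<open>Add\<close> adds parallel arrows, \<open>Zero X Y\<close> is the zero arrow from \<open>X\<close> to \<open>Y\<close>, and
  \<open>Comp C g f\<close>, written as an infix dot, is the composite "\<open>g\<close> after \<open>f\<close>".
\<close>

record ('o, 'a) additive_structure =
  Ob :: "'o set"
  Arr :: "'a set"
  Dom :: "'a \<Rightarrow> 'o"
  Cod :: "'a \<Rightarrow> 'o"
  Id :: "'o \<Rightarrow> 'a"
  Comp :: "'a \<Rightarrow> 'a \<Rightarrow> 'a"  (infixl \<open>\<cdot>\<index>\<close> 70)
  Add :: "'a \<Rightarrow> 'a \<Rightarrow> 'a"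
  Zero :: "'o \<Rightarrow> 'o \<Rightarrow> 'a"

definition Hom :: "('o, 'a) additive_structure \<Rightarrow> 'o \<Rightarrow> 'o \<Rightarrow> 'a set" where
  "Hom C X Y = {f \<in> Arr C. Dom C f = X \<and> Cod C f = Y}"

locale category =
  fixes C :: "('o, 'a) additive_structure" (structure)
  assumes Dom_in_Ob: "f \<in> Arr C \<Longrightarrow> Dom C f \<in> Ob C"
    and Cod_in_Ob: "f \<in> Arr C \<Longrightarrow> Cod C f \<in> Ob C"
    and Id_in_Hom: "X \<in> Ob C \<Longrightarrow> Id C X \<in> Hom C X X"
    and Comp_in_Hom: "\<lbrakk>f \<in> Hom C X Y; g \<in> Hom C Y Z\<rbrakk> \<Longrightarrow> g \<cdot> f \<in> Hom C X Z"
    and Comp_Id: "f \<in> Hom C X Y \<Longrightarrow> f \<cdot> Id C X = f"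
    and Id_Comp: "f \<in> Hom C X Y \<Longrightarrow> Id C Y \<cdot> f = f"
    and Comp_assoc:
      "\<lbrakk>f \<in> Hom C W X; g \<in> Hom C X Y; h \<in> Hom C Y Z\<rbrakk> \<Longrightarrow> (h \<cdot> g) \<cdot> f = h \<cdot> (g \<cdot> f)"

locale preadditive_category = category +
  assumes Hom_comm_group:
      "\<lbrakk>X \<in> Ob C; Y \<in> Ob C\<rbrakk> \<Longrightarrow>
        comm_group \<lparr>carrier = Hom C X Y, monoid.mult = Add C, one = Zero C X Y\<rparr>"
    and Comp_Add_right:
      "\<lbrakk>f \<in> Hom C X Y; f' \<in> Hom C X Y; g \<in> Hom C Y Z\<rbrakk> \<Longrightarrow>
        g \<cdot> (Add C f f') = Add C (g \<cdot> f) (g \<cdot> f')"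
    and Comp_Add_left:
      "\<lbrakk>f \<in> Hom C X Y; g \<in> Hom C Y Z; g' \<in> Hom C Y Z\<rbrakk> \<Longrightarrow>
        (Add C g g') \<cdot> f = Add C (g \<cdot> f) (g' \<cdot> f)"

definition mono_arrow :: "('o, 'a) additive_structure \<Rightarrow> 'a \<Rightarrow> bool" where
  "mono_arrow C f \<longleftrightarrow> f \<in> Arr C \<and>
    (\<forall>X. \<forall>g\<in>Hom C X (Dom C f). \<forall>h\<in>Hom C X (Dom C f). f \<cdot>\<^bsub>C\<^esub> g = f \<cdot>\<^bsub>C\<^esub> h \<longrightarrow> g = h)"

definition epi_arrow :: "('o, 'a) additive_structure \<Rightarrow> 'a \<Rightarrow> bool" where
  "epi_arrow C f \<longleftrightarrow> f \<in> Arr C \<and>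
    (\<forall>Y. \<forall>g\<in>Hom C (Cod C f) Y. \<forall>h\<in>Hom C (Cod C f) Y. g \<cdot>\<^bsub>C\<^esub> f = h \<cdot>\<^bsub>C\<^esub> f \<longrightarrow> g = h)"

definition zero_object :: "('o, 'a) additive_structure \<Rightarrow> 'o \<Rightarrow> bool" where
  "zero_object C Z \<longleftrightarrow> Z \<in> Ob C \<and>
    (\<forall>X\<in>Ob C. (\<exists>!f. f \<in> Hom C X Z) \<and> (\<exists>!f. f \<in> Hom C Z X))"

definition is_kernel :: "('o, 'a) additive_structure \<Rightarrow> 'a \<Rightarrow> 'a \<Rightarrow> bool" where
  "is_kernel C k f \<longleftrightarrow> f \<in> Arr C \<and> k \<in> Arr C \<and> Cod C k = Dom C f \<and>
    f \<cdot>\<^bsub>C\<^esub> k = Zero C (Dom C k) (Cod C f) \<and>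
    (\<forall>X. \<forall>h\<in>Hom C X (Dom C f). f \<cdot>\<^bsub>C\<^esub> h = Zero C X (Cod C f) \<longrightarrow>
      (\<exists>!u. u \<in> Hom C X (Dom C k) \<and> k \<cdot>\<^bsub>C\<^esub> u = h))"

definition is_cokernel :: "('o, 'a) additive_structure \<Rightarrow> 'a \<Rightarrow> 'a \<Rightarrow> bool" where
  "is_cokernel C q f \<longleftrightarrow> f \<in> Arr C \<and> q \<in> Arr C \<and> Dom C q = Cod C f \<and>
    q \<cdot>\<^bsub>C\<^esub> f = Zero C (Dom C f) (Cod C q) \<and>
    (\<forall>Y. \<forall>h\<in>Hom C (Cod C f) Y. h \<cdot>\<^bsub>C\<^esub> f = Zero C (Dom C f) Y \<longrightarrow>
      (\<exists>!u. u \<in> Hom C (Cod C q) Y \<and> u \<cdot>\<^bsub>C\<^esub> q = h))"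

definition is_biproduct ::
  "('o, 'a) additive_structure \<Rightarrow> 'o \<Rightarrow> 'o \<Rightarrow> 'o \<Rightarrow> 'a \<Rightarrow> 'a \<Rightarrow> 'a \<Rightarrow> 'a \<Rightarrow> bool" where
  "is_biproduct C P X Y i j p q \<longleftrightarrow>
    i \<in> Hom C X P \<and> j \<in> Hom C Y P \<and> p \<in> Hom C P X \<and> q \<in> Hom C P Y \<and>
    p \<cdot>\<^bsub>C\<^esub> i = Id C X \<and> q \<cdot>\<^bsub>C\<^esub> j = Id C Y \<and>
    p \<cdot>\<^bsub>C\<^esub> j = Zero C Y X \<and> q \<cdot>\<^bsub>C\<^esub> i = Zero C X Y \<and>
    Add C (i \<cdot>\<^bsub>C\<^esub> p) (j \<cdot>\<^bsub>C\<^esub> q) = Id C P"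

locale abelian_category = preadditive_category +
  assumes zero_object_exists: "\<exists>Z. zero_object C Z"
    and biproduct_exists:
      "\<lbrakk>X \<in> Ob C; Y \<in> Ob C\<rbrakk> \<Longrightarrow> \<exists>P\<in>Ob C. \<exists>i j p q. is_biproduct C P X Y i j p q"
    and kernel_exists: "f \<in> Arr C \<Longrightarrow> \<exists>k. is_kernel C k f"
    and cokernel_exists: "f \<in> Arr C \<Longrightarrow> \<exists>q. is_cokernel C q f"
    and mono_is_kernel: "mono_arrow C f \<Longrightarrow> \<exists>g. is_kernel C f g"
    and epi_is_cokernel: "epi_arrow C f \<Longrightarrow> \<exists>g. is_cokernel C f g"


section \<open>Exact sequences\<close>

text \<open>The image is the kernel of the cokernel.\<close>

definition is_image :: "('o, 'a) additive_structure \<Rightarrow> 'a \<Rightarrow> 'a \<Rightarrow> bool" where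
  "is_image C m f \<longleftrightarrow> (\<exists>q. is_cokernel C q f \<and> is_kernel C m q)"

definition exact_at :: "('o, 'a) additive_structure \<Rightarrow> 'a \<Rightarrow> 'a \<Rightarrow> bool" where
  "exact_at C f g \<longleftrightarrow> f \<in> Arr C \<and> g \<in> Arr C \<and> Cod C f = Dom C g \<and>
    (\<exists>m. is_image C m f \<and> is_kernel C m g)"

text \<open>
  A sequence of composable arrows is a list in diagrammatic order. The list
  \<open>[f\<^sub>0, \<dots>, f\<^sub>k]\<close> is \<open>exact_seq\<close> if \<open>0 \<rightarrow> X\<^sub>0 \<rightarrow> X\<^sub>1 \<rightarrow> \<dots> \<rightarrow> X\<^sub>k\<^sub>+\<^sub>1 \<rightarrow> 0\<close>, with \<open>f\<^sub>j\<close> from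
  \<open>X\<^sub>j\<close> to \<open>X\<^sub>j\<^sub>+\<^sub>1\<close>, is exact at each \<open>X\<^sub>j\<close>, including both ends.
\<close>

definition exact_seq :: "('o, 'a) additive_structure \<Rightarrow> 'a list \<Rightarrow> bool" where
  "exact_seq C fs \<longleftrightarrow> fs \<noteq> [] \<and>
    (\<exists>z z'. zero_object C (Dom C z) \<and> zero_object C (Cod C z') \<and>
      successively (exact_at C) (z # fs @ [z']))"

definition short_exact :: "('o, 'a) additive_structure \<Rightarrow> 'a \<Rightarrow> 'a \<Rightarrow> bool" where
  "short_exact C f g \<longleftrightarrow> exact_seq C [f, g]"


section \<open>Yoneda Ext\<close>

text \<open>
  For \<open>i \<ge> 1\<close>, an \<open>i\<close>-fold extension of \<open>X\<close> by \<open>Y\<close> is an exact sequence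
  \<open>0 \<rightarrow> Y \<rightarrow> E\<^sub>i\<^sub>-\<^sub>1 \<rightarrow> \<dots> \<rightarrow> E\<^sub>0 \<rightarrow> X \<rightarrow> 0\<close>, which has \<open>i + 1\<close> arrows between \<open>Y\<close> and \<open>X\<close>.
\<close>

definition extensions :: "('o, 'a) additive_structure \<Rightarrow> nat \<Rightarrow> 'o \<Rightarrow> 'o \<Rightarrow> 'a list set" where
  "extensions C i X Y =
    {fs. length fs = i + 1 \<and> Dom C (hd fs) = Y \<and> Cod C (last fs) = X \<and> exact_seq C fs}"

definition extension_morphism ::
  "('o, 'a) additive_structure \<Rightarrow> nat \<Rightarrow> 'o \<Rightarrow> 'o \<Rightarrow> 'a list \<Rightarrow> 'a list \<Rightarrow> 'a list \<Rightarrow> bool" where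
  "extension_morphism C i X Y fs gs hs \<longleftrightarrow>
    length hs = i + 2 \<and> hs ! 0 = Id C Y \<and> hs ! (i + 1) = Id C X \<and>
    (\<forall>j\<le>i. hs ! j \<in> Hom C (Dom C (fs ! j)) (Dom C (gs ! j)) \<and>
            hs ! (j + 1) \<cdot>\<^bsub>C\<^esub> fs ! j = gs ! j \<cdot>\<^bsub>C\<^esub> hs ! j)"

definition extension_rel ::
  "('o, 'a) additive_structure \<Rightarrow> nat \<Rightarrow> 'o \<Rightarrow> 'o \<Rightarrow> ('a list \<times> 'a list) set" where
  "extension_rel C i X Y =
    {(fs, gs). fs \<in> extensions C i X Y \<and> gs \<in> extensions C i X Y \<and>
               (\<exists>hs. extension_morphism C i X Y fs gs hs)}"

text \<open>
  Yoneda Ext, for \<open>i \<ge> 1\<close>: extensions modulo the equivalence relation generated by the morphisms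
  of extensions that are identities on \<open>Y\<close> and \<open>X\<close>.
\<close>

definition Ext :: "('o, 'a) additive_structure \<Rightarrow> nat \<Rightarrow> 'o \<Rightarrow> 'o \<Rightarrow> 'a list set set" where
  "Ext C i X Y =
    extensions C i X Y // (extension_rel C i X Y \<union> (extension_rel C i X Y)\<inverse>)\<^sup>*"

text \<open>
  \<open>Ext C i X Y\<close> is the carrier of an abelian group under the Baer sum, which is not needed here:
  a group is zero exactly if its carrier has a single element.
\<close>

definition Ext_vanishes ::
  "('o, 'a) additive_structure \<Rightarrow> nat \<Rightarrow> 'o set \<Rightarrow> 'o set \<Rightarrow> bool" where
  "Ext_vanishes C i \<A> \<B> \<longleftrightarrow> (\<forall>X\<in>\<A>. \<forall>Y\<in>\<B>. is_singleton (Ext C i X Y))"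

definition left_Ext1_orthogonal :: "('o, 'a) additive_structure \<Rightarrow> 'o set \<Rightarrow> 'o set" where
  "left_Ext1_orthogonal C \<B> = {X \<in> Ob C. Ext_vanishes C 1 {X} \<B>}"

definition right_Ext1_orthogonal :: "('o, 'a) additive_structure \<Rightarrow> 'o set \<Rightarrow> 'o set" where
  "right_Ext1_orthogonal C \<A> = {Y \<in> Ob C. Ext_vanishes C 1 \<A> {Y}}"


section \<open>Cotorsion pairs\<close>

text \<open>
  \<open>resolved_within C \<B> m\<close> consists of the objects \<open>X\<close> with an exact sequence
  \<open>0 \<rightarrow> B\<^sub>k \<rightarrow> \<dots> \<rightarrow> B\<^sub>0 \<rightarrow> X \<rightarrow> 0\<close> for some \<open>k \<le> m\<close>, all \<open>B\<^sub>j\<close> in \<open>\<B>\<close>; there are \<open>k + 1\<close> arrows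
  between \<open>B\<^sub>k\<close> and \<open>X\<close>, with domains the \<open>B\<^sub>j\<close>. Dually for \<open>coresolved_within\<close>.
\<close>

definition resolved_within ::
  "('o, 'a) additive_structure \<Rightarrow> 'o set \<Rightarrow> nat \<Rightarrow> 'o set" where
  "resolved_within C \<B> m =
    {X \<in> Ob C. \<exists>fs. exact_seq C fs \<and> length fs \<le> m + 1 \<and> Cod C (last fs) = X \<and>
                    (\<forall>f\<in>set fs. Dom C f \<in> \<B>)}"

definition coresolved_within ::
  "('o, 'a) additive_structure \<Rightarrow> 'o set \<Rightarrow> nat \<Rightarrow> 'o set" where
  "coresolved_within C \<A> m =
    {X \<in> Ob C. \<exists>fs. exact_seq C fs \<and> length fs \<le> m + 1 \<and> Dom C (hd fs) = X \<and>
                    (\<forall>f\<in>set fs. Cod C f \<in> \<A>)}"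

definition closed_under_summands :: "('o, 'a) additive_structure \<Rightarrow> 'o set \<Rightarrow> bool" where
  "closed_under_summands C \<X> \<longleftrightarrow>
    (\<forall>P\<in>\<X>. \<forall>X\<in>Ob C. \<forall>Y\<in>Ob C. (\<exists>i j p q. is_biproduct C P X Y i j p q) \<longrightarrow> X \<in> \<X>)"

definition left_n_cotorsion_pair ::
  "('o, 'a) additive_structure \<Rightarrow> nat \<Rightarrow> 'o set \<Rightarrow> 'o set \<Rightarrow> bool" where
  "left_n_cotorsion_pair C n \<A> \<B> \<longleftrightarrow>
    closed_under_summands C \<A> \<and>
    (\<forall>i. 1 \<le> i \<and> i \<le> n \<longrightarrow> Ext_vanishes C i \<A> \<B>) \<and>
    (\<forall>X\<in>Ob C. \<exists>f g. short_exact C f g \<and> Cod C g = X \<and>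
                     Dom C g \<in> \<A> \<and> Dom C f \<in> resolved_within C \<B> (n - 1))"

definition right_n_cotorsion_pair ::
  "('o, 'a) additive_structure \<Rightarrow> nat \<Rightarrow> 'o set \<Rightarrow> 'o set \<Rightarrow> bool" where
  "right_n_cotorsion_pair C n \<A> \<B> \<longleftrightarrow>
    closed_under_summands C \<B> \<and>
    (\<forall>i. 1 \<le> i \<and> i \<le> n \<longrightarrow> Ext_vanishes C i \<A> \<B>) \<and>
    (\<forall>X\<in>Ob C. \<exists>f g. short_exact C f g \<and> Dom C f = X \<and>
                     Cod C f \<in> \<B> \<and> Cod C g \<in> coresolved_within C \<A> (n - 1))"

definition n_cotorsion_pair ::
  "('o, 'a) additive_structure \<Rightarrow> nat \<Rightarrow> 'o set \<Rightarrow> 'o set \<Rightarrow> bool" where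
  "n_cotorsion_pair C n \<A> \<B> \<longleftrightarrow>
    left_n_cotorsion_pair C n \<A> \<B> \<and> right_n_cotorsion_pair C n \<A> \<B>"

definition complete_cotorsion_pair ::
  "('o, 'a) additive_structure \<Rightarrow> 'o set \<Rightarrow> 'o set \<Rightarrow> bool" where
  "complete_cotorsion_pair C \<A> \<B> \<longleftrightarrow>
    \<A> = left_Ext1_orthogonal C \<B> \<and> \<B> = right_Ext1_orthogonal C \<A> \<and>
    (\<forall>X\<in>Ob C. \<exists>f g. short_exact C f g \<and> Cod C g = X \<and> Dom C g \<in> \<A> \<and> Dom C f \<in> \<B>) \<and>
    (\<forall>X\<in>Ob C. \<exists>f g. short_exact C f g \<and> Dom C f = X \<and> Cod C f \<in> \<B> \<and> Cod C g \<in> \<A>)"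


section \<open>Resolving and coresolving classes\<close>

definition projective :: "('o, 'a) additive_structure \<Rightarrow> 'o \<Rightarrow> bool" where
  "projective C P \<longleftrightarrow> P \<in> Ob C \<and>
    (\<forall>e. epi_arrow C e \<longrightarrow>
      (\<forall>f\<in>Hom C P (Cod C e). \<exists>g\<in>Hom C P (Dom C e). e \<cdot>\<^bsub>C\<^esub> g = f))"

definition injective :: "('o, 'a) additive_structure \<Rightarrow> 'o \<Rightarrow> bool" where
  "injective C I \<longleftrightarrow> I \<in> Ob C \<and>
    (\<forall>m. mono_arrow C m \<longrightarrow>
      (\<forall>f\<in>Hom C (Dom C m) I. \<exists>g\<in>Hom C (Cod C m) I. g \<cdot>\<^bsub>C\<^esub> m = f))"

definition enough_projectives :: "('o, 'a) additive_structure \<Rightarrow> bool" where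
  "enough_projectives C \<longleftrightarrow>
    (\<forall>X\<in>Ob C. \<exists>e. epi_arrow C e \<and> Cod C e = X \<and> projective C (Dom C e))"

definition enough_injectives :: "('o, 'a) additive_structure \<Rightarrow> bool" where
  "enough_injectives C \<longleftrightarrow>
    (\<forall>X\<in>Ob C. \<exists>m. mono_arrow C m \<and> Dom C m = X \<and> injective C (Cod C m))"

definition closed_under_extensions :: "('o, 'a) additive_structure \<Rightarrow> 'o set \<Rightarrow> bool" where
  "closed_under_extensions C \<X> \<longleftrightarrow>
    (\<forall>f g. short_exact C f g \<and> Dom C f \<in> \<X> \<and> Cod C g \<in> \<X> \<longrightarrow> Cod C f \<in> \<X>)"

definition resolving :: "('o, 'a) additive_structure \<Rightarrow> 'o set \<Rightarrow> bool" where
  "resolving C \<X> \<longleftrightarrow>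
    closed_under_extensions C \<X> \<and>
    (\<forall>e k. epi_arrow C e \<and> Dom C e \<in> \<X> \<and> Cod C e \<in> \<X> \<and> is_kernel C k e \<longrightarrow> Dom C k \<in> \<X>) \<and>
    (\<forall>P. projective C P \<longrightarrow> P \<in> \<X>)"

definition coresolving :: "('o, 'a) additive_structure \<Rightarrow> 'o set \<Rightarrow> bool" where
  "coresolving C \<X> \<longleftrightarrow>
    closed_under_extensions C \<X> \<and>
    (\<forall>m q. mono_arrow C m \<and> Dom C m \<in> \<X> \<and> Cod C m \<in> \<X> \<and> is_cokernel C q m \<longrightarrow> Cod C q \<in> \<X>) \<and>
    (\<forall>I. injective C I \<longrightarrow> I \<in> \<X>)"

definition hereditary_complete_cotorsion_pair ::
  "('o, 'a) additive_structure \<Rightarrow> 'o set \<Rightarrow> 'o set \<Rightarrow> bool" where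
  "hereditary_complete_cotorsion_pair C \<A> \<B> \<longleftrightarrow>
    complete_cotorsion_pair C \<A> \<B> \<and> resolving C \<A> \<and> coresolving C \<B>"

end

theory Submission
  imports Defs
begin

text \<open>
  The condition on \<open>Ext\<^sup>1\<close> says that short exact sequences from \<open>\<B>\<close> to \<open>\<A>\<close> split.
  If \<open>\<B>\<close> is coresolving, a left approximation has kernel in \<open>\<B>\<close>, and pulling an embedding
  \<open>X \<rightarrow> B \<rightarrow> L\<close> back along a left approximation of \<open>L\<close> gives a right approximation of \<open>X\<close> (Salce),
  so \<open>(\<A>, \<B>)\<close> is a complete cotorsion pair. Membership in \<open>\<A>\<close> amounts to lifting along
  epimorphisms within \<open>\<B>\<close>, which makes \<open>\<A>\<close> resolving with no recourse to \<open>Ext\<^sup>2\<close> and without enough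
  projectives or injectives. The case of resolving \<open>\<A>\<close> is dual.

  Conversely, over a hereditary complete cotorsion pair, pushing a Yoneda extension of \<open>X \<in> \<A>\<close> by
  \<open>Y \<in> \<B>\<close> out along embeddings into \<open>\<B>\<close> keeps all cosyzygies in \<open>\<B>\<close>, so the last epimorphism
  splits; and the trivial extension maps to every extension whose last epimorphism splits.
\<close>

section \<open>Arithmetic of arrows\<close>

text \<open>The obstacle is closure of \<A> under kernels of epimorphisms. The usual argument shifts
  dimension along a long exact sequence and so needs functorial Ext in degree two, while Ext is here
  a bare set of classes of lists. Lifting replaces it. If B in \<B> is the kernel of Z \<rightarrow>
  X and Z embeds into B' in \<B>, then B'/B lies in \<B>, and the given extension is the pullback of
  B' \<rightarrow> B'/B along X \<rightarrow> B'/B. It therefore splits once the latter map lifts. A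
  map from the kernel of an epimorphism within \<A> to B'/B extends to the middle term by
  orthogonality in degree one, lifts there, and restricts back to the kernel.

  Dual facts are mostly instances of proved ones in the opposite category, which keeps objects and
  arrows. Ext itself is never dualized: it is first exchanged for splitting of short exact
  sequences, a self-dual condition.

  In the converse direction Ext of every degree has to be met with lists. The induction peels short
  exact sequences off the left end, and the component of the chain map at that end changes from step
  to step.\<close>

context category
begin

text \<open>Membership in \<open>Hom\<close> mentions source and target as parameters that the
  simplifier would have to guess. Equations for \<open>Dom\<close> and \<open>Cod\<close> let it
  settle composability by rewriting, so most later facts are stated in this form.\<close>

lemma Arr_Comp [simp]: "\<lbrakk>f \<in> Arr C; g \<in> Arr C; Cod C f = Dom C g\<rbrakk> \<Longrightarrow> g \<cdot> f \<in> Arr C"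
  and Dom_Comp [simp]: "\<lbrakk>f \<in> Arr C; g \<in> Arr C; Cod C f = Dom C g\<rbrakk> \<Longrightarrow> Dom C (g \<cdot> f) = Dom C f"
  and Cod_Comp [simp]: "\<lbrakk>f \<in> Arr C; g \<in> Arr C; Cod C f = Dom C g\<rbrakk> \<Longrightarrow> Cod C (g \<cdot> f) = Cod C g"
  using Comp_in_Hom[of f "Dom C f" "Cod C f" g "Cod C g"] by (auto simp: Hom_def)

lemma Arr_Id [simp]: "X \<in> Ob C \<Longrightarrow> Id C X \<in> Arr C"
  and Dom_Id [simp]: "X \<in> Ob C \<Longrightarrow> Dom C (Id C X) = X"
  and Cod_Id [simp]: "X \<in> Ob C \<Longrightarrow> Cod C (Id C X) = X"
  using Id_in_Hom[of X] by (auto simp: Hom_def)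

lemma Comp_Id_Dom [simp]: "\<lbrakk>f \<in> Arr C; Dom C f = X\<rbrakk> \<Longrightarrow> f \<cdot> Id C X = f"
  and Id_Cod_Comp [simp]: "\<lbrakk>f \<in> Arr C; Cod C f = X\<rbrakk> \<Longrightarrow> Id C X \<cdot> f = f"
  using Comp_Id[of f X "Cod C f"] Id_Comp[of f "Dom C f" X] by (auto simp: Hom_def)

lemma Arr_Comp_assoc:
  "\<lbrakk>f \<in> Arr C; g \<in> Arr C; h \<in> Arr C; Cod C f = Dom C g; Cod C g = Dom C h\<rbrakk>
    \<Longrightarrow> (h \<cdot> g) \<cdot> f = h \<cdot> (g \<cdot> f)"
  using Comp_assoc[of f "Dom C f" "Cod C f" g "Cod C g" h "Cod C h"] by (auto simp: Hom_def)

declare Dom_in_Ob [simp] Cod_in_Ob [simp]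

end

context preadditive_category
begin

abbreviation hom_group where
  "hom_group f \<equiv> \<lparr>carrier = Hom C (Dom C f) (Cod C f), monoid.mult = Add C,
                   one = Zero C (Dom C f) (Cod C f)\<rparr>"

text \<open>The inverse is taken in the Hom group of the subtrahend, from which source and target
  can be read off. The value is meaningful for parallel arrows only.\<close>

definition Sub where
  "Sub f g = Add C f (inv\<^bsub>hom_group g\<^esub> g)"

lemma comm_group_hom_group: "f \<in> Arr C \<Longrightarrow> comm_group (hom_group f)"
  by (simp add: Hom_comm_group)

lemma Arr_Zero [simp]: "\<lbrakk>X \<in> Ob C; Y \<in> Ob C\<rbrakk> \<Longrightarrow> Zero C X Y \<in> Arr C"
  and Dom_Zero [simp]: "\<lbrakk>X \<in> Ob C; Y \<in> Ob C\<rbrakk> \<Longrightarrow> Dom C (Zero C X Y) = X"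
  and Cod_Zero [simp]: "\<lbrakk>X \<in> Ob C; Y \<in> Ob C\<rbrakk> \<Longrightarrow> Cod C (Zero C X Y) = Y"
  using monoid.one_closed[OF group.is_monoid[OF comm_group.axioms(2)[OF Hom_comm_group[of X Y]]]]
  by (auto simp: Hom_def)

lemma Arr_Add [simp]:
    "\<lbrakk>f \<in> Arr C; g \<in> Arr C; Dom C f = Dom C g; Cod C f = Cod C g\<rbrakk> \<Longrightarrow> Add C f g \<in> Arr C"
  and Dom_Add [simp]:
    "\<lbrakk>f \<in> Arr C; g \<in> Arr C; Dom C f = Dom C g; Cod C f = Cod C g\<rbrakk> \<Longrightarrow> Dom C (Add C f g) = Dom C g"
  and Cod_Add [simp]:
    "\<lbrakk>f \<in> Arr C; g \<in> Arr C; Dom C f = Dom C g; Cod C f = Cod C g\<rbrakk> \<Longrightarrow> Cod C (Add C f g) = Cod C g"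
  using monoid.m_closed[OF group.is_monoid[OF comm_group.axioms(2)[OF comm_group_hom_group[of g]]], of f g]
  by (auto simp: Hom_def)

lemma Add_Zero [simp]: "\<lbrakk>f \<in> Arr C; Dom C f = X; Cod C f = Y\<rbrakk> \<Longrightarrow> Add C f (Zero C X Y) = f"
  and Zero_Add [simp]: "\<lbrakk>f \<in> Arr C; Dom C f = X; Cod C f = Y\<rbrakk> \<Longrightarrow> Add C (Zero C X Y) f = f"
  using monoid.r_one[OF group.is_monoid[OF comm_group.axioms(2)[OF comm_group_hom_group[of f]]], of f]
    monoid.l_one[OF group.is_monoid[OF comm_group.axioms(2)[OF comm_group_hom_group[of f]]], of f]
  by (auto simp: Hom_def)

lemma Arr_Comp_Add:
  "\<lbrakk>f \<in> Arr C; f' \<in> Arr C; g \<in> Arr C; Dom C f = Dom C f'; Cod C f = Dom C g; Cod C f' = Dom C g\<rbrakk>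
    \<Longrightarrow> g \<cdot> (Add C f f') = Add C (g \<cdot> f) (g \<cdot> f')"
  using Comp_Add_right[of f "Dom C f'" "Dom C g" f' g "Cod C g"] by (auto simp: Hom_def)

lemma Arr_Add_Comp:
  "\<lbrakk>g \<in> Arr C; g' \<in> Arr C; f \<in> Arr C; Cod C g = Cod C g'; Dom C g = Cod C f; Dom C g' = Cod C f\<rbrakk>
    \<Longrightarrow> (Add C g g') \<cdot> f = Add C (g \<cdot> f) (g' \<cdot> f)"
  using Comp_Add_left[of f "Dom C f" "Cod C f" g "Cod C g'" g'] by (auto simp: Hom_def)

text \<open>Cancellation in the Hom group. By additivity, a composite with a zero arrow equals its
  own double, and this turns that into the absorption laws below.\<close>

lemma Add_self_eq_iff:
  assumes "f \<in> Arr C" "Add C f f = f" shows "f = Zero C (Dom C f) (Cod C f)"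
proof -
  interpret G: comm_group "hom_group f" using assms by (rule_tac comm_group_hom_group)
  show ?thesis using G.r_cancel_one'[of f f] assms by (auto simp: Hom_def)
qed

lemma Comp_Zero [simp]:
  assumes "g \<in> Arr C" "X \<in> Ob C" "Dom C g = Y" shows "g \<cdot> Zero C X Y = Zero C X (Cod C g)"
proof -
  have "Y \<in> Ob C" using assms by auto
  then show ?thesis
    using Add_self_eq_iff[of "g \<cdot> Zero C X Y"] Arr_Comp_Add[of "Zero C X Y" "Zero C X Y" g] assms
    by simp
qed

lemma Zero_Comp [simp]:
  assumes "f \<in> Arr C" "Z \<in> Ob C" "Cod C f = Y" shows "Zero C Y Z \<cdot> f = Zero C (Dom C f) Z"
proof -
  have "Y \<in> Ob C" using assms by auto
  then show ?thesis
    using Add_self_eq_iff[of "Zero C Y Z \<cdot> f"] Arr_Add_Comp[of "Zero C Y Z" "Zero C Y Z" f] assms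
    by simp
qed

lemma
  assumes "f \<in> Arr C" "g \<in> Arr C" "Dom C f = Dom C g" "Cod C f = Cod C g"
  shows Arr_Sub [simp]: "Sub f g \<in> Arr C"
    and Dom_Sub [simp]: "Dom C (Sub f g) = Dom C g"
    and Cod_Sub [simp]: "Cod C (Sub f g) = Cod C g"
    and Add_Sub: "Add C g (Sub f g) = f"
    and Sub_eq_Zero_iff: "Sub f g = Zero C (Dom C g) (Cod C g) \<longleftrightarrow> f = g"
proof -
  interpret G: comm_group "hom_group g" using assms by (rule_tac comm_group_hom_group)
  have fg: "f \<in> carrier (hom_group g)" "g \<in> carrier (hom_group g)"
    using assms by (auto simp: Hom_def)
  have Sub: "Sub f g = f \<otimes>\<^bsub>hom_group g\<^esub> inv\<^bsub>hom_group g\<^esub> g"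
    by (simp add: Sub_def)
  have "Sub f g \<in> carrier (hom_group g)"
    unfolding Sub using fg by blast
  then show "Sub f g \<in> Arr C" "Dom C (Sub f g) = Dom C g" "Cod C (Sub f g) = Cod C g"
    by (auto simp: Hom_def)
  have "g \<otimes>\<^bsub>hom_group g\<^esub> Sub f g = f"
    unfolding Sub using fg by (metis G.inv_closed G.m_closed G.m_comm G.inv_solve_right)
  then show "Add C g (Sub f g) = f" by simp
  have "Sub f g = \<one>\<^bsub>hom_group g\<^esub> \<longleftrightarrow> f = g"
    unfolding Sub using fg by (metis G.inv_closed G.inv_equality G.inv_inv G.r_inv)
  then show "Sub f g = Zero C (Dom C g) (Cod C g) \<longleftrightarrow> f = g" by simp
qed

lemma Add_left_cancel:
  assumes "Add C f g = Add C f h" "f \<in> Arr C" "g \<in> Arr C" "h \<in> Arr C"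
    "Dom C f = Dom C g" "Cod C f = Cod C g" "Dom C f = Dom C h" "Cod C f = Cod C h"
  shows "g = h"
proof -
  interpret G: comm_group "hom_group f" using assms by (rule_tac comm_group_hom_group)
  have "f \<in> carrier (hom_group f)" "g \<in> carrier (hom_group f)" "h \<in> carrier (hom_group f)"
    using assms by (auto simp: Hom_def)
  then show ?thesis using assms(1) G.Units_l_cancel[of f g h] G.Units_eq by simp
qed

lemma Arr_Add_commute:
  "\<lbrakk>f \<in> Arr C; g \<in> Arr C; Dom C f = Dom C g; Cod C f = Cod C g\<rbrakk> \<Longrightarrow> Add C f g = Add C g f"
  using comm_monoid.m_comm[OF comm_group.axioms(1)[OF comm_group_hom_group[of g]], of f g]
  by (simp add: Hom_def)

lemma Comp_Sub:
  assumes "f \<in> Arr C" "f' \<in> Arr C" "g \<in> Arr C" "Dom C f = Dom C f'"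
    "Cod C f = Dom C g" "Cod C f' = Dom C g"
  shows "g \<cdot> Sub f f' = Sub (g \<cdot> f) (g \<cdot> f')"
proof (rule Add_left_cancel)
  show "Add C (g \<cdot> f') (g \<cdot> Sub f f') = Add C (g \<cdot> f') (Sub (g \<cdot> f) (g \<cdot> f'))"
    using assms by (simp add: Arr_Comp_Add[symmetric] Add_Sub)
qed (use assms in auto)

lemma Sub_Comp:
  assumes "g \<in> Arr C" "g' \<in> Arr C" "f \<in> Arr C" "Cod C g = Cod C g'"
    "Dom C g = Cod C f" "Dom C g' = Cod C f"
  shows "Sub g g' \<cdot> f = Sub (g \<cdot> f) (g' \<cdot> f)"
proof (rule Add_left_cancel)
  show "Add C (g' \<cdot> f) (Sub g g' \<cdot> f) = Add C (g' \<cdot> f) (Sub (g \<cdot> f) (g' \<cdot> f))"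
    using assms by (simp add: Arr_Add_Comp[symmetric] Add_Sub)
qed (use assms in auto)

lemma Sub_Zero [simp]:
  assumes "f \<in> Arr C" "Dom C f = X" "Cod C f = Y" shows "Sub f (Zero C X Y) = f"
proof -
  have "X \<in> Ob C" "Y \<in> Ob C" using assms by auto
  then show ?thesis using assms Add_Sub[of f "Zero C X Y"] by simp
qed

section \<open>Monomorphisms, kernels and cokernels in a preadditive category\<close>

lemma mono_arrowI:
  assumes f: "f \<in> Arr C"
    and inj: "\<And>h. \<lbrakk>h \<in> Arr C; Cod C h = Dom C f; f \<cdot> h = Zero C (Dom C h) (Cod C f)\<rbrakk>
      \<Longrightarrow> h = Zero C (Dom C h) (Dom C f)"
  shows "mono_arrow C f"
  unfolding mono_arrow_def
proof (intro conjI allI ballI impI f)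
  fix X g h assume "g \<in> Hom C X (Dom C f)" "h \<in> Hom C X (Dom C f)" and eq: "f \<cdot> g = f \<cdot> h"
  then have g: "g \<in> Arr C" "Dom C g = X" "Cod C g = Dom C f"
    and h: "h \<in> Arr C" "Dom C h = X" "Cod C h = Dom C f" by (auto simp: Hom_def)
  have "f \<cdot> Sub g h = Zero C X (Cod C f)"
    using f g h eq Sub_eq_Zero_iff[of "f \<cdot> g" "f \<cdot> h"] by (simp add: Comp_Sub)
  then show "g = h" using inj[of "Sub g h"] f g h Sub_eq_Zero_iff[of g h] by simp
qed

lemma mono_arrow_cancel:
  assumes "mono_arrow C f" "f \<cdot> g = f \<cdot> h" "g \<in> Arr C" "h \<in> Arr C"
    "Cod C g = Dom C f" "Cod C h = Dom C f" "Dom C g = Dom C h"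
  shows "g = h"
  using assms unfolding mono_arrow_def Hom_def by blast

lemma epi_arrow_cancel:
  assumes "epi_arrow C f" "g \<cdot> f = h \<cdot> f" "g \<in> Arr C" "h \<in> Arr C"
    "Dom C g = Cod C f" "Dom C h = Cod C f" "Cod C g = Cod C h"
  shows "g = h"
  using assms unfolding epi_arrow_def Hom_def by blast

lemma is_kernelD:
  assumes "is_kernel C k f"
  shows "f \<in> Arr C" "k \<in> Arr C" "Cod C k = Dom C f" "f \<cdot> k = Zero C (Dom C k) (Cod C f)"
  using assms unfolding is_kernel_def by auto

lemma is_cokernelD:
  assumes "is_cokernel C q f"
  shows "f \<in> Arr C" "q \<in> Arr C" "Dom C q = Cod C f" "q \<cdot> f = Zero C (Dom C f) (Cod C q)"
  using assms unfolding is_cokernel_def by auto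

lemma kernel_lift:
  assumes "is_kernel C k f" "h \<in> Arr C" "Cod C h = Dom C f" "f \<cdot> h = Zero C (Dom C h) (Cod C f)"
  obtains u where "u \<in> Arr C" "Dom C u = Dom C h" "Cod C u = Dom C k" "k \<cdot> u = h"
  using assms unfolding is_kernel_def Hom_def by blast

lemma cokernel_lift:
  assumes "is_cokernel C q f" "h \<in> Arr C" "Dom C h = Cod C f" "h \<cdot> f = Zero C (Dom C f) (Cod C h)"
  obtains u where "u \<in> Arr C" "Dom C u = Cod C q" "Cod C u = Cod C h" "u \<cdot> q = h"
  using assms unfolding is_cokernel_def Hom_def by blast

text \<open>If \<open>k \<cdot> h\<close> is zero, then \<open>h\<close> and the zero arrow are two
  factorizations of the same zero arrow through \<open>k\<close>, and factorizations are
  unique.\<close>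

lemma kernel_mono:
  assumes k: "is_kernel C k f" shows "mono_arrow C k"
proof (rule mono_arrowI)
  show "k \<in> Arr C" by (rule is_kernelD[OF k])
  fix h assume h: "h \<in> Arr C" "Cod C h = Dom C k" "k \<cdot> h = Zero C (Dom C h) (Cod C k)"
  have zero: "Zero C (Dom C h) (Dom C f) \<in> Hom C (Dom C h) (Dom C f)"
    "f \<cdot> Zero C (Dom C h) (Dom C f) = Zero C (Dom C h) (Cod C f)"
    using h is_kernelD[OF k] by (simp_all add: Hom_def)
  have "\<exists>!u. u \<in> Hom C (Dom C h) (Dom C k) \<and> k \<cdot> u = Zero C (Dom C h) (Dom C f)"
    using k zero unfolding is_kernel_def by blast
  moreover have "h \<in> Hom C (Dom C h) (Dom C k) \<and> k \<cdot> h = Zero C (Dom C h) (Dom C f)"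
    "Zero C (Dom C h) (Dom C k) \<in> Hom C (Dom C h) (Dom C k) \<and>
     k \<cdot> Zero C (Dom C h) (Dom C k) = Zero C (Dom C h) (Dom C f)"
    using h is_kernelD[OF k] by (simp_all add: Hom_def)
  ultimately show "h = Zero C (Dom C h) (Dom C k)" by blast
qed

lemma is_kernelI:
  assumes "mono_arrow C k" "f \<in> Arr C" "Cod C k = Dom C f" "f \<cdot> k = Zero C (Dom C k) (Cod C f)"
    and "\<And>h. \<lbrakk>h \<in> Arr C; Cod C h = Dom C f; f \<cdot> h = Zero C (Dom C h) (Cod C f)\<rbrakk>
      \<Longrightarrow> \<exists>u. u \<in> Arr C \<and> Dom C u = Dom C h \<and> Cod C u = Dom C k \<and> k \<cdot> u = h"
  shows "is_kernel C k f"
  unfolding is_kernel_def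
proof (intro conjI allI ballI impI)
  fix X h assume h: "h \<in> Hom C X (Dom C f)" "f \<cdot> h = Zero C X (Cod C f)"
  then obtain u where u: "u \<in> Hom C X (Dom C k)" "k \<cdot> u = h"
    using assms(5)[of h] by (auto simp: Hom_def)
  moreover have "v = u" if "v \<in> Hom C X (Dom C k)" "k \<cdot> v = h" for v
    using that u assms(1) unfolding mono_arrow_def by blast
  ultimately show "\<exists>!u. u \<in> Hom C X (Dom C k) \<and> k \<cdot> u = h" by blast
qed (use assms in \<open>auto simp: mono_arrow_def\<close>)

end

section \<open>The opposite category\<close>

text \<open>Object and arrow sets are kept as they are, so that classes \<A> and \<B> transfer
  literally; a dual statement arises by instantiation and rewriting with the simp rules that
  follow.\<close>

definition opposite :: "('o, 'a) additive_structure \<Rightarrow> ('o, 'a) additive_structure" where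
  "opposite C = \<lparr>Ob = Ob C, Arr = Arr C, Dom = Cod C, Cod = Dom C, Id = Id C,
     Comp = (\<lambda>g f. f \<cdot>\<^bsub>C\<^esub> g), Add = Add C, Zero = (\<lambda>X Y. Zero C Y X)\<rparr>"

lemma opposite_simps [simp]:
  "Ob (opposite C) = Ob C" "Arr (opposite C) = Arr C" "Dom (opposite C) = Cod C"
  "Cod (opposite C) = Dom C" "Id (opposite C) = Id C" "Comp (opposite C) g f = Comp C f g"
  "Add (opposite C) = Add C" "Zero (opposite C) X Y = Zero C Y X"
  by (simp_all add: opposite_def)

lemma Hom_opposite [simp]: "Hom (opposite C) X Y = Hom C Y X"
  by (auto simp: Hom_def)

lemma opposite_opposite [simp]: "opposite (opposite C) = C"
  by (simp add: opposite_def)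

lemma mono_arrow_opposite [simp]: "mono_arrow (opposite C) f \<longleftrightarrow> epi_arrow C f"
  and epi_arrow_opposite [simp]: "epi_arrow (opposite C) f \<longleftrightarrow> mono_arrow C f"
  and zero_object_opposite [simp]: "zero_object (opposite C) X \<longleftrightarrow> zero_object C X"
  and is_kernel_opposite [simp]: "is_kernel (opposite C) f g \<longleftrightarrow> is_cokernel C f g"
  and is_cokernel_opposite [simp]: "is_cokernel (opposite C) f g \<longleftrightarrow> is_kernel C f g"
  and is_biproduct_opposite [simp]:
    "is_biproduct (opposite C) P X Y i j p q \<longleftrightarrow> is_biproduct C P X Y p q i j"
  and projective_opposite [simp]: "projective (opposite C) X \<longleftrightarrow> injective C X"
  and injective_opposite [simp]: "injective (opposite C) X \<longleftrightarrow> projective C X"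
  by (auto simp: mono_arrow_def epi_arrow_def zero_object_def is_kernel_def is_cokernel_def
      is_biproduct_def projective_def injective_def)

lemma closed_under_summands_opposite [simp]:
  "closed_under_summands (opposite C) \<X> \<longleftrightarrow> closed_under_summands C \<X>"
proof -
  have "(\<exists>i j p q. is_biproduct C P X Y p q i j) \<longleftrightarrow> (\<exists>i j p q. is_biproduct C P X Y i j p q)" for P X Y
    by blast
  then show ?thesis by (simp add: closed_under_summands_def)
qed

lemma (in abelian_category) abelian_opposite: "abelian_category (opposite C)"
proof (intro abelian_category.intro preadditive_category.intro category.intro
    preadditive_category_axioms.intro abelian_category_axioms.intro)
  show "\<exists>Z. zero_object (opposite C) Z" using zero_object_exists by simp
  show "\<exists>P\<in>Ob (opposite C). \<exists>i j p q. is_biproduct (opposite C) P X Y i j p q"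
    if XY: "X \<in> Ob (opposite C)" "Y \<in> Ob (opposite C)" for X Y
  proof -
    obtain P i j p q where "P \<in> Ob C" "is_biproduct C P X Y i j p q"
      using biproduct_exists[of X Y] XY by auto
    then have "P \<in> Ob (opposite C)" "is_biproduct (opposite C) P X Y p q i j" by simp_all
    then show ?thesis by blast
  qed
next
  fix f assume "f \<in> Arr (opposite C)"
  then show "\<exists>k. is_kernel (opposite C) k f" "\<exists>q. is_cokernel (opposite C) q f"
    using kernel_exists[of f] cokernel_exists[of f] by simp_all
next
  fix f assume "mono_arrow (opposite C) f"
  then show "\<exists>g. is_kernel (opposite C) f g" using epi_is_cokernel[of f] by simp
next
  fix f assume "epi_arrow (opposite C) f"
  then show "\<exists>g. is_cokernel (opposite C) f g" using mono_is_kernel[of f] by simp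
next
  fix X Y assume "X \<in> Ob (opposite C)" "Y \<in> Ob (opposite C)"
  then show "comm_group \<lparr>carrier = Hom (opposite C) X Y, monoid.mult = Add (opposite C),
      one = Zero (opposite C) X Y\<rparr>"
    using Hom_comm_group[of Y X] by simp
next
  fix X Y Z f g assume "f \<in> Hom (opposite C) X Y" "g \<in> Hom (opposite C) Y Z"
  then show "g \<cdot>\<^bsub>opposite C\<^esub> f \<in> Hom (opposite C) X Z"
    using Comp_in_Hom[of g Z Y f X] by simp
next
  fix W X Y Z f g h
  assume "f \<in> Hom (opposite C) W X" "g \<in> Hom (opposite C) X Y" "h \<in> Hom (opposite C) Y Z"
  then show "(h \<cdot>\<^bsub>opposite C\<^esub> g) \<cdot>\<^bsub>opposite C\<^esub> f = h \<cdot>\<^bsub>opposite C\<^esub> (g \<cdot>\<^bsub>opposite C\<^esub> f)"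
    using Comp_assoc[of h Z Y g X f W] by simp
next
  fix X Y Z f f' g
  assume "f \<in> Hom (opposite C) X Y" "f' \<in> Hom (opposite C) X Y" "g \<in> Hom (opposite C) Y Z"
  then show "g \<cdot>\<^bsub>opposite C\<^esub> Add (opposite C) f f' =
      Add (opposite C) (g \<cdot>\<^bsub>opposite C\<^esub> f) (g \<cdot>\<^bsub>opposite C\<^esub> f')"
    using Comp_Add_left[of g Z Y f X f'] by simp
next
  fix X Y Z f g g'
  assume "f \<in> Hom (opposite C) X Y" "g \<in> Hom (opposite C) Y Z" "g' \<in> Hom (opposite C) Y Z"
  then show "Add (opposite C) g g' \<cdot>\<^bsub>opposite C\<^esub> f =
      Add (opposite C) (g \<cdot>\<^bsub>opposite C\<^esub> f) (g' \<cdot>\<^bsub>opposite C\<^esub> f)"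
    using Comp_Add_right[of g Z Y g' f X] by simp
qed (simp_all add: Id_in_Hom Comp_Id Id_Comp)


section \<open>Short exact sequences, pullbacks and pushouts\<close>

text \<open>A list-free form of \<open>short_exact\<close>, to which it is proved equivalent below.
  It is visibly symmetric under duality.\<close>

definition ses :: "('o, 'a) additive_structure \<Rightarrow> 'a \<Rightarrow> 'a \<Rightarrow> bool" where
  "ses C f g \<longleftrightarrow> is_kernel C f g \<and> is_cokernel C g f"

text \<open>Only a section is recorded. For short exact sequences a retraction of the monomorphism
  is equivalent, which makes the notion self-dual there.\<close>

definition split :: "('o, 'a) additive_structure \<Rightarrow> 'a \<Rightarrow> bool" where
  "split C g \<longleftrightarrow> (\<exists>s\<in>Hom C (Cod C g) (Dom C g). g \<cdot>\<^bsub>C\<^esub> s = Id C (Cod C g))"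

lemma ses_opposite [simp]: "ses (opposite C) g f \<longleftrightarrow> ses C f g"
  by (auto simp: ses_def)

context abelian_category
begin

lemma cokernel_epi: "is_cokernel C q f \<Longrightarrow> epi_arrow C q"
  using preadditive_category.kernel_mono[OF abelian_category.axioms(1)[OF abelian_opposite], of q f]
  by simp

lemma epi_arrowI:
  assumes "f \<in> Arr C"
    and "\<And>h. \<lbrakk>h \<in> Arr C; Dom C h = Cod C f; h \<cdot> f = Zero C (Dom C f) (Cod C h)\<rbrakk>
      \<Longrightarrow> h = Zero C (Cod C f) (Cod C h)"
  shows "epi_arrow C f"
  using preadditive_category.mono_arrowI[OF abelian_category.axioms(1)[OF abelian_opposite], of f] assms
  by simp

lemma is_cokernelI:
  assumes "epi_arrow C q" "f \<in> Arr C" "Dom C q = Cod C f" "q \<cdot> f = Zero C (Dom C f) (Cod C q)"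
    and "\<And>h. \<lbrakk>h \<in> Arr C; Dom C h = Cod C f; h \<cdot> f = Zero C (Dom C f) (Cod C h)\<rbrakk>
      \<Longrightarrow> \<exists>u. u \<in> Arr C \<and> Dom C u = Cod C q \<and> Cod C u = Cod C h \<and> u \<cdot> q = h"
  shows "is_cokernel C q f"
  using preadditive_category.is_kernelI[OF abelian_category.axioms(1)[OF abelian_opposite], of q f] assms
  by simp metis

lemma mono_arrow_Arr [simp]: "mono_arrow C f \<Longrightarrow> f \<in> Arr C"
  and epi_arrow_Arr [simp]: "epi_arrow C f \<Longrightarrow> f \<in> Arr C"
  by (simp_all add: mono_arrow_def epi_arrow_def)

text \<open>Since \<open>g\<close> kills \<open>k\<close>, it factors through the cokernel as
  \<open>t \<cdot> q\<close>. Hence \<open>g\<close> kills whatever \<open>q\<close> kills, and the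
  universal property for \<open>g\<close> serves for \<open>q\<close>.\<close>

lemma kernel_of_cokernel:
  assumes k: "is_kernel C k g" and q: "is_cokernel C q k"
  shows "is_kernel C k q"
proof (rule is_kernelI)
  note kD = is_kernelD[OF k] and qD = is_cokernelD[OF q]
  show "mono_arrow C k" by (rule kernel_mono[OF k])
  show "q \<in> Arr C" "Cod C k = Dom C q" "q \<cdot> k = Zero C (Dom C k) (Cod C q)" using qD by simp_all
  obtain t where t: "t \<in> Arr C" "Dom C t = Cod C q" "Cod C t = Cod C g" "t \<cdot> q = g"
    using cokernel_lift[OF q, of g] kD by auto
  fix h assume h: "h \<in> Arr C" "Cod C h = Dom C q" "q \<cdot> h = Zero C (Dom C h) (Cod C q)"
  have "g \<cdot> h = t \<cdot> (q \<cdot> h)" using t(1-3) h qD by (simp add: Arr_Comp_assoc flip: t(4))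
  then have "g \<cdot> h = Zero C (Dom C h) (Cod C g)" using t h qD by simp
  then show "\<exists>u. u \<in> Arr C \<and> Dom C u = Dom C h \<and> Cod C u = Dom C k \<and> k \<cdot> u = h"
    using kernel_lift[OF k, of h] h qD kD by metis
qed

lemma cokernel_of_kernel: "\<lbrakk>is_cokernel C q f; is_kernel C k q\<rbrakk> \<Longrightarrow> is_cokernel C q k"
  using abelian_category.kernel_of_cokernel[OF abelian_opposite, of q f k] by simp

text \<open>The axiom that monomorphisms are kernels enters here: a monomorphism is the kernel of
  some arrow, hence of its own cokernel.\<close>

lemma ses_monoI: "\<lbrakk>mono_arrow C f; is_cokernel C g f\<rbrakk> \<Longrightarrow> ses C f g"
  using mono_is_kernel kernel_of_cokernel unfolding ses_def by blast

lemma ses_epiI: "\<lbrakk>epi_arrow C g; is_kernel C f g\<rbrakk> \<Longrightarrow> ses C f g"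
  using epi_is_cokernel cokernel_of_kernel unfolding ses_def by blast

lemma mono_ses: "mono_arrow C f \<Longrightarrow> \<exists>g. ses C f g"
  using cokernel_exists[of f] ses_monoI[of f] by auto

lemma sesD:
  assumes "ses C f g"
  shows "f \<in> Arr C" "g \<in> Arr C" "Cod C f = Dom C g" "g \<cdot> f = Zero C (Dom C f) (Cod C g)"
    "mono_arrow C f" "epi_arrow C g" "is_kernel C f g" "is_cokernel C g f"
  using assms is_kernelD[of f g] kernel_mono cokernel_epi unfolding ses_def by auto

text \<open>A prime marks the side parallel to the unprimed arrow: \<open>a'\<close> is the base
  change of \<open>a\<close> along \<open>b\<close>, and \<open>b'\<close> that of \<open>b\<close>
  along \<open>a\<close>. Uniqueness is a separate last clause, the joint monicity of the
  projections.\<close>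

definition is_pullback :: "'b \<Rightarrow> 'b \<Rightarrow> 'b \<Rightarrow> 'b \<Rightarrow> bool" where
  "is_pullback a b a' b' \<longleftrightarrow>
    a \<in> Arr C \<and> b \<in> Arr C \<and> a' \<in> Arr C \<and> b' \<in> Arr C \<and> Cod C a = Cod C b \<and>
    Dom C a' = Dom C b' \<and> Cod C a' = Dom C b \<and> Cod C b' = Dom C a \<and> a \<cdot> b' = b \<cdot> a' \<and>
    (\<forall>x\<in>Arr C. \<forall>y\<in>Arr C. Dom C x = Dom C y \<and> Cod C x = Dom C a \<and> Cod C y = Dom C b \<and>
      a \<cdot> x = b \<cdot> y \<longrightarrow> (\<exists>u\<in>Hom C (Dom C x) (Dom C b'). b' \<cdot> u = x \<and> a' \<cdot> u = y)) \<and>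
    (\<forall>W. \<forall>u\<in>Hom C W (Dom C b'). \<forall>v\<in>Hom C W (Dom C b').
      b' \<cdot> u = b' \<cdot> v \<and> a' \<cdot> u = a' \<cdot> v \<longrightarrow> u = v)"

lemma is_pullback_commute: "is_pullback a b a' b' \<Longrightarrow> is_pullback b a b' a'"
  unfolding is_pullback_def by (safe; metis)

lemma biproductD:
  assumes "is_biproduct C P X Y i j p q"
  shows "i \<in> Arr C" "Dom C i = X" "Cod C i = P" "j \<in> Arr C" "Dom C j = Y" "Cod C j = P"
    "p \<in> Arr C" "Dom C p = P" "Cod C p = X" "q \<in> Arr C" "Dom C q = P" "Cod C q = Y"
    "p \<cdot> i = Id C X" "q \<cdot> j = Id C Y" "p \<cdot> j = Zero C Y X" "q \<cdot> i = Zero C X Y"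
    "Add C (i \<cdot> p) (j \<cdot> q) = Id C P" "P \<in> Ob C" "X \<in> Ob C" "Y \<in> Ob C"
  using assms unfolding is_biproduct_def Hom_def by auto

text \<open>The identity of \<open>P\<close> is the sum of \<open>i \<cdot> p\<close> and
  \<open>j \<cdot> q\<close>, so an arrow into \<open>P\<close> is rebuilt from its two
  projections.\<close>

lemma biproduct_projections_cancel:
  assumes "is_biproduct C P X Y i j p q" "p \<cdot> u = p \<cdot> v" "q \<cdot> u = q \<cdot> v"
    "u \<in> Arr C" "v \<in> Arr C" "Cod C u = P" "Cod C v = P"
  shows "u = v"
proof -
  note D = biproductD[OF assms(1)]
  have expand: "Add C (i \<cdot> (p \<cdot> w)) (j \<cdot> (q \<cdot> w)) = w" if "w \<in> Arr C" "Cod C w = P" for w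
  proof -
    have "w = Add C (i \<cdot> p) (j \<cdot> q) \<cdot> w" using that D by simp
    also have "\<dots> = Add C (i \<cdot> (p \<cdot> w)) (j \<cdot> (q \<cdot> w))"
      using that D(1-12) by (simp add: Arr_Add_Comp Arr_Comp_assoc)
    finally show ?thesis by simp
  qed
  show ?thesis using expand[of u] expand[of v] assms(2-) by metis
qed

text \<open>The pullback is the kernel of the difference \<open>d\<close> of
  \<open>a \<cdot> p\<close> and \<open>b \<cdot> q\<close> on the biproduct. Epimorphisms are
  stable: if \<open>a\<close> is epi, so is \<open>d\<close>, because \<open>d \<cdot> i\<close> is
  \<open>a\<close>. If \<open>t\<close> kills \<open>q \<cdot> k\<close>, then
  \<open>t \<cdot> q\<close> is some \<open>w \<cdot> d\<close>; restricting along \<open>i\<close>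
  shows that \<open>w \<cdot> a\<close> is zero, so \<open>w\<close> is zero, and restricting along
  \<open>j\<close> shows that \<open>t\<close> is zero. The case of \<open>b\<close> exchanges the
  two summands.\<close>

lemma pullback_exists:
  assumes a: "a \<in> Arr C" and b: "b \<in> Arr C" and Z: "Cod C a = Cod C b"
  obtains a' b' where "is_pullback a b a' b'"
    "epi_arrow C a \<Longrightarrow> epi_arrow C a'" "epi_arrow C b \<Longrightarrow> epi_arrow C b'"
proof -
  obtain P i j p q where bp: "is_biproduct C P (Dom C a) (Dom C b) i j p q"
    using biproduct_exists[of "Dom C a" "Dom C b"] a b by auto
  note D = biproductD[OF bp]
  define d where "d = Sub (a \<cdot> p) (b \<cdot> q)"
  have d: "d \<in> Arr C" "Dom C d = P" "Cod C d = Cod C b"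
    using D a b Z by (simp_all add: d_def)
  have d_comp: "d \<cdot> w = Sub (a \<cdot> (p \<cdot> w)) (b \<cdot> (q \<cdot> w))" if "w \<in> Arr C" "Cod C w = P" for w
    using that D(1-12) a b Z by (simp add: d_def Sub_Comp Arr_Comp_assoc)
  obtain k where k: "is_kernel C k d" using kernel_exists d by blast
  have kD: "k \<in> Arr C" "Cod C k = P" "d \<cdot> k = Zero C (Dom C k) (Cod C b)"
    using is_kernelD[OF k] d by simp_all
  have di: "d \<cdot> i = a" using D a b Z d_comp[of i] by simp
  have pb: "is_pullback a b (q \<cdot> k) (p \<cdot> k)"
    unfolding is_pullback_def
  proof (intro conjI ballI allI impI)
    show "a \<cdot> (p \<cdot> k) = b \<cdot> (q \<cdot> k)"
      using kD d_comp[of k] Sub_eq_Zero_iff[of "a \<cdot> (p \<cdot> k)" "b \<cdot> (q \<cdot> k)"] D(1-12) a b Z by simp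
  next
    fix x y assume x: "x \<in> Arr C" and y: "y \<in> Arr C"
      and eq: "Dom C x = Dom C y \<and> Cod C x = Dom C a \<and> Cod C y = Dom C b \<and> a \<cdot> x = b \<cdot> y"
    define h where "h = Add C (i \<cdot> x) (j \<cdot> y)"
    have h: "h \<in> Arr C" "Dom C h = Dom C y" "Cod C h = P"
      using x y eq D(1-12) by (simp_all add: h_def)
    have ph: "p \<cdot> h = x"
    proof -
      have "p \<cdot> h = Add C (p \<cdot> (i \<cdot> x)) (p \<cdot> (j \<cdot> y))"
        using x y eq D(1-12) by (simp add: h_def Arr_Comp_Add)
      also have "\<dots> = Add C ((p \<cdot> i) \<cdot> x) ((p \<cdot> j) \<cdot> y)"
        using x y eq D(1-12) by (simp add: Arr_Comp_assoc)
      finally show ?thesis using x y eq D by simp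
    qed
    have qh: "q \<cdot> h = y"
    proof -
      have "q \<cdot> h = Add C (q \<cdot> (i \<cdot> x)) (q \<cdot> (j \<cdot> y))"
        using x y eq D(1-12) by (simp add: h_def Arr_Comp_Add)
      also have "\<dots> = Add C ((q \<cdot> i) \<cdot> x) ((q \<cdot> j) \<cdot> y)"
        using x y eq D(1-12) by (simp add: Arr_Comp_assoc)
      finally show ?thesis using x y eq D by simp
    qed
    have "d \<cdot> h = Zero C (Dom C h) (Cod C d)"
      using d_comp[of h] h d ph qh eq y b Sub_eq_Zero_iff[of "b \<cdot> y" "b \<cdot> y"] by simp
    then obtain u where u: "u \<in> Arr C" "Dom C u = Dom C h" "Cod C u = Dom C k" "k \<cdot> u = h"
      using kernel_lift[OF k, of h] h d by auto
    then show "\<exists>u\<in>Hom C (Dom C x) (Dom C (p \<cdot> k)). (p \<cdot> k) \<cdot> u = x \<and> (q \<cdot> k) \<cdot> u = y"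
      using h ph qh kD D(1-12) eq by (auto simp: Hom_def Arr_Comp_assoc)
  next
    fix W u v assume "u \<in> Hom C W (Dom C (p \<cdot> k))" "v \<in> Hom C W (Dom C (p \<cdot> k))"
      and eq: "(p \<cdot> k) \<cdot> u = (p \<cdot> k) \<cdot> v \<and> (q \<cdot> k) \<cdot> u = (q \<cdot> k) \<cdot> v"
    then have uv: "u \<in> Arr C" "Dom C u = W" "Cod C u = Dom C k"
      "v \<in> Arr C" "Dom C v = W" "Cod C v = Dom C k"
      using kD D(1-12) by (auto simp: Hom_def)
    then have "k \<cdot> u = k \<cdot> v"
      using biproduct_projections_cancel[OF bp, of "k \<cdot> u" "k \<cdot> v"] eq kD D(1-12)
      by (simp add: Arr_Comp_assoc)
    then show "u = v" using mono_arrow_cancel[OF kernel_mono[OF k]] uv by simp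
  qed (use a b Z D kD in simp_all)
  \<comment> \<open>An epimorphism is the cokernel of its kernel, so arrows killing \<open>k\<close>
    factor through \<open>d\<close>.\<close>
  have factor: "w \<in> Arr C \<Longrightarrow> w \<cdot> k = Zero C (Dom C k) (Cod C w) \<Longrightarrow> Dom C w = P \<Longrightarrow> epi_arrow C d \<Longrightarrow>
    \<exists>t. t \<in> Arr C \<and> Dom C t = Cod C b \<and> Cod C t = Cod C w \<and> t \<cdot> d = w" for w
    using ses_epiI[OF _ k] cokernel_lift[of d k w] sesD(8)[of k d] kD d by metis
  \<comment> \<open>Restricted to the second summand, \<open>d\<close> is minus \<open>b\<close>;
    whatever kills it therefore kills \<open>b\<close>.\<close>
  have dj: "t \<cdot> (d \<cdot> j) = Zero C (Dom C b) (Cod C t) \<Longrightarrow> t \<cdot> b = Zero C (Dom C b) (Cod C t)"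
    if "t \<in> Arr C" "Dom C t = Cod C b" for t
  proof -
    have "t \<cdot> (d \<cdot> j) = Sub (Zero C (Dom C b) (Cod C t)) (t \<cdot> b)"
      using D a b Z d_comp[of j] that by (simp add: Comp_Sub)
    then show "t \<cdot> (d \<cdot> j) = Zero C (Dom C b) (Cod C t) \<Longrightarrow> t \<cdot> b = Zero C (Dom C b) (Cod C t)"
      using Sub_eq_Zero_iff[of "Zero C (Dom C b) (Cod C t)" "t \<cdot> b"] that b by simp
  qed
  have zero_cancel: "t = Zero C (Dom C t) (Cod C t)"
    if "epi_arrow C e" "t \<cdot> e = Zero C (Dom C e) (Cod C t)" "t \<in> Arr C" "Dom C t = Cod C e" for t e
    using that epi_arrow_cancel[of e t "Zero C (Dom C t) (Cod C t)"] by simp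
  have epi_a: "epi_arrow C (q \<cdot> k)" if ea: "epi_arrow C a"
  proof (rule epi_arrowI)
    have "epi_arrow C d"
    proof (rule epi_arrowI[OF d(1)])
      fix t assume t: "t \<in> Arr C" "Dom C t = Cod C d" "t \<cdot> d = Zero C (Dom C d) (Cod C t)"
      have "t \<cdot> a = (t \<cdot> d) \<cdot> i" using t(1,2) d D(1-12) by (simp add: di Arr_Comp_assoc)
      then have "t \<cdot> a = Zero C (Dom C a) (Cod C t)" using t d D by simp
      then show "t = Zero C (Cod C d) (Cod C t)" using zero_cancel[OF ea, of t] t d Z by simp
    qed
    fix t assume t: "t \<in> Arr C" "Dom C t = Cod C (q \<cdot> k)"
      "t \<cdot> (q \<cdot> k) = Zero C (Dom C (q \<cdot> k)) (Cod C t)"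
    then have t': "Dom C t = Dom C b" "(t \<cdot> q) \<cdot> k = Zero C (Dom C k) (Cod C t)"
      using D(1-12) kD by (simp_all add: Arr_Comp_assoc)
    then obtain w where w: "w \<in> Arr C" "Dom C w = Cod C b" "Cod C w = Cod C t" "w \<cdot> d = t \<cdot> q"
      using factor[of "t \<cdot> q"] \<open>epi_arrow C d\<close> t D(1-12) by auto
    have "w \<cdot> a = (w \<cdot> d) \<cdot> i" using w(1-3) d D(1-12) by (simp add: di Arr_Comp_assoc)
    also have "\<dots> = t \<cdot> (q \<cdot> i)" using t(1) t'(1) D(1-12) by (simp add: w(4) Arr_Comp_assoc)
    also have "\<dots> = Zero C (Dom C a) (Cod C w)" using t t' w D by simp
    finally have w0: "w = Zero C (Cod C b) (Cod C w)" using zero_cancel[OF ea, of w] w Z by simp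
    have "t = (t \<cdot> q) \<cdot> j" using t(1) t'(1) D by (simp add: Arr_Comp_assoc)
    also have "\<dots> = w \<cdot> (d \<cdot> j)" using w(1-3) d D(1-12) by (simp add: Arr_Comp_assoc flip: w(4))
    also have "\<dots> = Zero C (Dom C b) (Cod C w)" using w t(1) d D b by (subst w0) simp
    finally show "t = Zero C (Cod C (q \<cdot> k)) (Cod C t)" using w t t' kD D(1-12) by simp
  qed (use D kD in simp)
  have epi_b: "epi_arrow C (p \<cdot> k)" if eb: "epi_arrow C b"
  proof (rule epi_arrowI)
    have "epi_arrow C d"
    proof (rule epi_arrowI[OF d(1)])
      fix t assume t: "t \<in> Arr C" "Dom C t = Cod C d" "t \<cdot> d = Zero C (Dom C d) (Cod C t)"
      have "t \<cdot> (d \<cdot> j) = (t \<cdot> d) \<cdot> j" using t(1,2) d D(1-12) by (simp add: Arr_Comp_assoc)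
      then have "t \<cdot> b = Zero C (Dom C b) (Cod C t)" using t d D dj[of t] by simp
      then show "t = Zero C (Cod C d) (Cod C t)" using zero_cancel[OF eb, of t] t d Z by simp
    qed
    fix t assume t: "t \<in> Arr C" "Dom C t = Cod C (p \<cdot> k)"
      "t \<cdot> (p \<cdot> k) = Zero C (Dom C (p \<cdot> k)) (Cod C t)"
    then have t': "Dom C t = Dom C a" "(t \<cdot> p) \<cdot> k = Zero C (Dom C k) (Cod C t)"
      using D(1-12) kD by (simp_all add: Arr_Comp_assoc)
    then obtain w where w: "w \<in> Arr C" "Dom C w = Cod C b" "Cod C w = Cod C t" "w \<cdot> d = t \<cdot> p"
      using factor[of "t \<cdot> p"] \<open>epi_arrow C d\<close> t D(1-12) by auto
    have "w \<cdot> (d \<cdot> j) = (w \<cdot> d) \<cdot> j" using w(1-3) d D(1-12) by (simp add: Arr_Comp_assoc)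
    also have "\<dots> = t \<cdot> (p \<cdot> j)" using t(1) t'(1) D(1-12) by (simp add: w(4) Arr_Comp_assoc)
    also have "\<dots> = Zero C (Dom C b) (Cod C w)" using t t' w D by simp
    finally have w0: "w = Zero C (Cod C b) (Cod C w)" using dj[of w] zero_cancel[OF eb, of w] w Z by simp
    have "t = (t \<cdot> p) \<cdot> i" using t(1) t'(1) D by (simp add: Arr_Comp_assoc)
    also have "\<dots> = w \<cdot> (d \<cdot> i)" using w(1-3) d D(1-12) by (simp add: Arr_Comp_assoc flip: w(4))
    also have "\<dots> = Zero C (Dom C a) (Cod C w)" using w t(1) d D a Z di by (subst w0) simp
    finally show "t = Zero C (Cod C (p \<cdot> k)) (Cod C t)" using w t t' kD D(1-12) by simp
  qed (use D kD in simp)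
  show ?thesis using that[OF pb epi_a epi_b] .
qed

text \<open>The pair consisting of \<open>k\<close> and a zero arrow is compatible with
  \<open>a\<close> and \<open>b\<close>, so it induces \<open>k'\<close>. An arrow killed by
  \<open>a'\<close> has its other projection killed by \<open>a\<close>, and that projection factors
  through \<open>k\<close>.\<close>

lemma pullback_kernel:
  assumes pb: "is_pullback a b a' b'" and k: "is_kernel C k a"
  obtains k' where "is_kernel C k' a'" "Dom C k' = Dom C k" "b' \<cdot> k' = k"
proof -
  have D: "a \<in> Arr C" "b \<in> Arr C" "a' \<in> Arr C" "b' \<in> Arr C" "Cod C a = Cod C b"
    "Dom C a' = Dom C b'" "Cod C a' = Dom C b" "Cod C b' = Dom C a" "a \<cdot> b' = b \<cdot> a'"
    and lift: "\<And>x y. \<lbrakk>x \<in> Arr C; y \<in> Arr C; Dom C x = Dom C y; Cod C x = Dom C a; Cod C y = Dom C b;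
      a \<cdot> x = b \<cdot> y\<rbrakk> \<Longrightarrow> \<exists>u\<in>Hom C (Dom C x) (Dom C b'). b' \<cdot> u = x \<and> a' \<cdot> u = y"
    and cancel: "\<And>u v. \<lbrakk>u \<in> Arr C; v \<in> Arr C; Dom C u = Dom C v; Cod C u = Dom C b'; Cod C v = Dom C b';
      b' \<cdot> u = b' \<cdot> v; a' \<cdot> u = a' \<cdot> v\<rbrakk> \<Longrightarrow> u = v"
    using pb unfolding is_pullback_def Hom_def by blast+
  note kD = is_kernelD[OF k]
  have "\<exists>k'\<in>Hom C (Dom C k) (Dom C b'). b' \<cdot> k' = k \<and> a' \<cdot> k' = Zero C (Dom C k) (Dom C b)"
    by (rule lift) (use D(1-8) kD in simp_all)
  then obtain k' where k'0: "k' \<in> Hom C (Dom C k) (Dom C b')" and k'': "b' \<cdot> k' = k"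
    "a' \<cdot> k' = Zero C (Dom C k) (Dom C b)" by blast
  have k': "k' \<in> Arr C" "Dom C k' = Dom C k" "Cod C k' = Dom C b'"
    using k'0 unfolding Hom_def by blast+
  have mono_k': "mono_arrow C k'"
  proof (rule mono_arrowI[OF k'(1)])
    fix h assume h: "h \<in> Arr C" "Cod C h = Dom C k'" "k' \<cdot> h = Zero C (Dom C h) (Cod C k')"
    have "(b' \<cdot> k') \<cdot> h = b' \<cdot> (k' \<cdot> h)" using h(1,2) k' D(1-8) by (simp add: Arr_Comp_assoc)
    then have "k \<cdot> h = k \<cdot> Zero C (Dom C h) (Dom C k')" using h k' k'' D kD by simp
    then show "h = Zero C (Dom C h) (Dom C k')"
      using mono_arrow_cancel[OF kernel_mono[OF k]] h k' kD by simp
  qed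
  have "is_kernel C k' a'"
  proof (rule is_kernelI[OF mono_k'])
    fix h assume h: "h \<in> Arr C" "Cod C h = Dom C a'" "a' \<cdot> h = Zero C (Dom C h) (Cod C a')"
    have "a \<cdot> (b' \<cdot> h) = (a \<cdot> b') \<cdot> h" using h D(1-8) by (simp add: Arr_Comp_assoc)
    also have "\<dots> = b \<cdot> (a' \<cdot> h)" using h D by (simp add: Arr_Comp_assoc)
    also have "\<dots> = Zero C (Dom C h) (Cod C a)" using h D by simp
    finally obtain u where u: "u \<in> Arr C" "Dom C u = Dom C h" "Cod C u = Dom C k" "k \<cdot> u = b' \<cdot> h"
      using kernel_lift[OF k, of "b' \<cdot> h"] h D(1-8) by auto
    have "k' \<cdot> u = h"
    proof (rule cancel)
      show "b' \<cdot> (k' \<cdot> u) = b' \<cdot> h" using u k' k'' D(1-8) by (simp flip: Arr_Comp_assoc)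
      have "a' \<cdot> (k' \<cdot> u) = (a' \<cdot> k') \<cdot> u" using u k' D(1-8) by (simp add: Arr_Comp_assoc)
      then show "a' \<cdot> (k' \<cdot> u) = a' \<cdot> h" using u k' k'' h D(1-8) by simp
    qed (use u k' h D(1-8) in simp_all)
    then show "\<exists>u. u \<in> Arr C \<and> Dom C u = Dom C h \<and> Cod C u = Dom C k' \<and> k' \<cdot> u = h"
      using u k' by auto
  qed (use D k' k'' in simp_all)
  then show ?thesis using that k' k'' by blast
qed

lemma pullback_ses:
  assumes ka: "ses C k a" and b: "b \<in> Arr C" "Cod C b = Cod C a"
  obtains k' a' b' where "ses C k' a'" "Dom C k' = Dom C k" "Cod C a' = Dom C b"
    "b' \<in> Arr C" "Dom C b' = Dom C a'" "Cod C b' = Dom C a" "b' \<cdot> k' = k" "a \<cdot> b' = b \<cdot> a'"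
proof -
  note D = sesD[OF ka]
  obtain a' b' where pb: "is_pullback a b a' b'" "epi_arrow C a'"
    using pullback_exists[of a b] D b by metis
  obtain k' where k': "is_kernel C k' a'" "Dom C k' = Dom C k" "b' \<cdot> k' = k"
    using pullback_kernel[OF pb(1) D(7)] .
  show ?thesis
    by (rule that[OF ses_epiI[OF pb(2) k'(1)] k'(2) _ _ _ _ k'(3)])
      (use pb(1) in \<open>auto simp: is_pullback_def\<close>)
qed

text \<open>Base change of two epimorphisms along each other puts two short exact sequences through
  one middle object. This is the diagram behind the Salce argument.\<close>

lemma pullback_two_ses:
  assumes ka: "ses C k a" and lb: "ses C l b" and Z: "Cod C a = Cod C b"
  obtains k' a' l' b' where "ses C k' a'" "Dom C k' = Dom C k" "Cod C a' = Dom C b"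
    "ses C l' b'" "Dom C l' = Dom C l" "Cod C b' = Dom C a" "Cod C l' = Cod C k'"
proof -
  note D = sesD[OF ka] and E = sesD[OF lb]
  obtain a' b' where pb: "is_pullback a b a' b'" "epi_arrow C a'" "epi_arrow C b'"
    using pullback_exists[of a b] D E Z by metis
  obtain k' where k': "is_kernel C k' a'" "Dom C k' = Dom C k"
    using pullback_kernel[OF pb(1) D(7)] .
  obtain l' where l': "is_kernel C l' b'" "Dom C l' = Dom C l"
    using pullback_kernel[OF is_pullback_commute[OF pb(1)] E(7)] .
  show ?thesis
    by (rule that[OF ses_epiI[OF pb(2) k'(1)] k'(2) _ ses_epiI[OF pb(3) l'(1)] l'(2)])
      (use pb(1) is_kernelD[OF k'(1)] is_kernelD[OF l'(1)] in \<open>auto simp: is_pullback_def\<close>)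
qed

lemma pushout_ses:
  assumes "ses C k a" "b \<in> Arr C" "Dom C b = Dom C k"
  obtains k' a' b' where "ses C k' a'" "Cod C a' = Cod C a" "Dom C k' = Cod C b"
    "b' \<in> Arr C" "Dom C b' = Cod C k" "Cod C b' = Cod C k'" "a' \<cdot> b' = a" "b' \<cdot> k = k' \<cdot> b"
  using abelian_category.pullback_ses[OF abelian_opposite, of a k b] assms by simp metis

text \<open>The identity minus \<open>s \<cdot> g\<close> is killed by \<open>g\<close>, so it
  factors through the kernel as \<open>f \<cdot> r\<close>. Cancelling the monomorphism
  \<open>f\<close> gives the remaining identities for \<open>r\<close>.\<close>

lemma split_biproduct:
  assumes fg: "ses C f g" and s: "s \<in> Hom C (Cod C g) (Dom C g)" "g \<cdot> s = Id C (Cod C g)"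
  obtains r where "is_biproduct C (Dom C g) (Dom C f) (Cod C g) f s r g"
proof -
  note D = sesD[OF fg]
  have s': "s \<in> Arr C" "Dom C s = Cod C g" "Cod C s = Dom C g" using s(1) by (auto simp: Hom_def)
  define t where "t = Sub (Id C (Dom C g)) (s \<cdot> g)"
  have t: "t \<in> Arr C" "Dom C t = Dom C g" "Cod C t = Dom C g" using s' D by (simp_all add: t_def)
  have "g \<cdot> t = Sub g ((g \<cdot> s) \<cdot> g)" using s' D(1-3) by (simp add: t_def Comp_Sub Arr_Comp_assoc)
  then have "g \<cdot> t = Zero C (Dom C t) (Cod C g)"
    using s(2) D t Sub_eq_Zero_iff[of g g] by simp
  then obtain r where r: "r \<in> Arr C" "Dom C r = Dom C g" "Cod C r = Dom C f" "f \<cdot> r = t"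
    using kernel_lift[OF D(7), of t] t by auto
  have "f \<cdot> (r \<cdot> f) = t \<cdot> f" using r D(1-3) by (simp flip: Arr_Comp_assoc)
  also have "\<dots> = Sub f (s \<cdot> (g \<cdot> f))" using s' D(1-3) by (simp add: t_def Sub_Comp Arr_Comp_assoc)
  also have "\<dots> = f \<cdot> Id C (Dom C f)" using s' D by simp
  finally have rf: "r \<cdot> f = Id C (Dom C f)" using mono_arrow_cancel[OF D(5)] r D by simp
  have "f \<cdot> (r \<cdot> s) = t \<cdot> s" using r s' D(1-3) by (simp flip: Arr_Comp_assoc)
  also have "\<dots> = Sub s (s \<cdot> (g \<cdot> s))" using s' D(1-3) by (simp add: t_def Sub_Comp Arr_Comp_assoc)
  also have "\<dots> = Zero C (Cod C g) (Dom C g)" using s s' Sub_eq_Zero_iff[of s s] by simp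
  also have "\<dots> = f \<cdot> Zero C (Cod C g) (Dom C f)" using D by simp
  finally have rs: "r \<cdot> s = Zero C (Cod C g) (Dom C f)" using mono_arrow_cancel[OF D(5)] r s' D by simp
  have "Add C (s \<cdot> g) t = Id C (Dom C g)" unfolding t_def using s' D by (intro Add_Sub) simp_all
  then have "Add C (f \<cdot> r) (s \<cdot> g) = Id C (Dom C g)"
    using r s' t D Arr_Add_commute[of t "s \<cdot> g"] by simp
  then show ?thesis
    using that[of r] rf rs r s s' D unfolding is_biproduct_def by (simp add: Hom_def)
qed

lemma retraction_split:
  assumes fg: "ses C f g" and r: "r \<in> Hom C (Cod C f) (Dom C f)" "r \<cdot> f = Id C (Dom C f)"
  shows "split C g"
proof -
  obtain s where "is_biproduct (opposite C) (Cod C f) (Cod C g) (Dom C f) g r s f"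
    using abelian_category.split_biproduct[OF abelian_opposite, of g f r] fg r by auto
  then show ?thesis using sesD[OF fg] unfolding is_biproduct_def split_def by auto
qed

lemma split_retraction:
  assumes fg: "ses C f g" and "split C g"
  obtains r where "r \<in> Arr C" "Dom C r = Cod C f" "Cod C r = Dom C f" "r \<cdot> f = Id C (Dom C f)"
  using assms split_biproduct[OF fg] sesD[OF fg] unfolding split_def is_biproduct_def Hom_def by auto

lemma split_opposite: "ses C f g \<Longrightarrow> split (opposite C) f \<longleftrightarrow> split C g"
  using split_retraction[of f g] retraction_split[of f g] by (auto simp: split_def Hom_def)

end

section \<open>Exact sequences\<close>

context abelian_category
begin

text \<open>As kernels of the same \<open>q\<close>, the arrows \<open>m\<close> and
  \<open>f\<close> represent the same subobject, so either may replace the other as a kernel of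
  \<open>g\<close>.\<close>

lemma kernel_cong:
  assumes "is_kernel C m q" "is_kernel C f q" "is_kernel C m g"
  shows "is_kernel C f g"
proof (rule is_kernelI)
  note mq = is_kernelD[OF assms(1)] and fq = is_kernelD[OF assms(2)] and mg = is_kernelD[OF assms(3)]
  show "mono_arrow C f" using kernel_mono assms(2) .
  show "g \<in> Arr C" "Cod C f = Dom C g" using mq fq mg by simp_all
  obtain u where u: "u \<in> Arr C" "Dom C u = Dom C f" "Cod C u = Dom C m" "m \<cdot> u = f"
    using kernel_lift[OF assms(1), of f] fq by metis
  have "(g \<cdot> m) \<cdot> u = g \<cdot> (m \<cdot> u)" using u(1-3) mg(1-3) by (simp add: Arr_Comp_assoc)
  then show "g \<cdot> f = Zero C (Dom C f) (Cod C g)" using u mg by simp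
  fix h assume h: "h \<in> Arr C" "Cod C h = Dom C g" "g \<cdot> h = Zero C (Dom C h) (Cod C g)"
  then obtain w where w: "w \<in> Arr C" "Dom C w = Dom C h" "Cod C w = Dom C m" "m \<cdot> w = h"
    using kernel_lift[OF assms(3), of h] by metis
  have "(q \<cdot> m) \<cdot> w = q \<cdot> (m \<cdot> w)" using w(1-3) mq(1-3) by (simp add: Arr_Comp_assoc)
  then have "q \<cdot> h = Zero C (Dom C h) (Cod C q)" using w mq by simp
  then show "\<exists>u. u \<in> Arr C \<and> Dom C u = Dom C h \<and> Cod C u = Dom C f \<and> f \<cdot> u = h"
    using kernel_lift[OF assms(2), of h] h mq(3) mg(3) by metis
qed

text \<open>The image is defined asymmetrically, as a kernel of a cokernel. Naming both the
  subobject \<open>m\<close> and the quotient \<open>q\<close> gives a form that duality preserves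
  by exchanging \<open>m\<close> and \<open>q\<close>.\<close>

lemma exact_at_iff:
  "exact_at C f g \<longleftrightarrow> (\<exists>m q. ses C m q \<and> is_cokernel C q f \<and> is_kernel C m g)"
proof
  assume "exact_at C f g"
  then obtain m q where "is_cokernel C q f" "is_kernel C m q" "is_kernel C m g"
    unfolding exact_at_def is_image_def by blast
  then show "\<exists>m q. ses C m q \<and> is_cokernel C q f \<and> is_kernel C m g"
    using cokernel_of_kernel unfolding ses_def by blast
next
  assume "\<exists>m q. ses C m q \<and> is_cokernel C q f \<and> is_kernel C m g"
  then obtain m q where "ses C m q" "is_cokernel C q f" "is_kernel C m g" by blast
  then show "exact_at C f g"
    using sesD[of m q] is_cokernelD[of q f] is_kernelD[of m g]
    unfolding exact_at_def is_image_def by auto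
qed

lemma exact_at_opposite [simp]: "exact_at (opposite C) g f \<longleftrightarrow> exact_at C f g"
  using abelian_category.exact_at_iff[OF abelian_opposite] exact_at_iff by auto

text \<open>A monomorphism is its own image, being the kernel of its cokernel.\<close>

lemma exact_at_mono_iff:
  assumes f: "mono_arrow C f" shows "exact_at C f g \<longleftrightarrow> is_kernel C f g"
proof
  assume "exact_at C f g"
  then obtain m q where mq: "ses C m q" "is_cokernel C q f" "is_kernel C m g"
    using exact_at_iff by blast
  then show "is_kernel C f g" using kernel_cong ses_monoI[OF f mq(2)] sesD(7) by blast
next
  assume "is_kernel C f g"
  then show "exact_at C f g" using exact_at_iff mono_ses[OF f] sesD(8) by blast
qed

lemma exact_at_epi_iff: "epi_arrow C g \<Longrightarrow> exact_at C f g \<longleftrightarrow> is_cokernel C g f"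
  using abelian_category.exact_at_mono_iff[OF abelian_opposite, of g f] by simp

lemma zero_object_Dom_eq:
  "\<lbrakk>zero_object C Z; f \<in> Arr C; g \<in> Arr C; Dom C f = Z; Dom C g = Z; Cod C f = Cod C g\<rbrakk> \<Longrightarrow> f = g"
  unfolding zero_object_def Hom_def using Cod_in_Ob[of g] by blast

lemma zero_object_Cod_eq:
  "\<lbrakk>zero_object C Z; f \<in> Arr C; g \<in> Arr C; Cod C f = Z; Cod C g = Z; Dom C f = Dom C g\<rbrakk> \<Longrightarrow> f = g"
  unfolding zero_object_def Hom_def using Dom_in_Ob[of g] by blast

lemma zero_object_Ob [simp]: "zero_object C Z \<Longrightarrow> Z \<in> Ob C"
  by (simp add: zero_object_def)

lemma zero_object_mono: "\<lbrakk>zero_object C Z; z \<in> Arr C; Dom C z = Z\<rbrakk> \<Longrightarrow> mono_arrow C z"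
  by (rule mono_arrowI) (auto intro: zero_object_Cod_eq)

lemma exact_at_from_zero_iff:
  assumes Z: "zero_object C Z" and z: "z \<in> Arr C" "Dom C z = Z" and f: "f \<in> Arr C" "Cod C z = Dom C f"
  shows "exact_at C z f \<longleftrightarrow> mono_arrow C f"
proof -
  have z0: "z = Zero C Z (Dom C f)" using zero_object_Dom_eq[OF Z] z f Z by simp
  have fz: "f \<cdot> z = Zero C (Dom C z) (Cod C f)" using zero_object_Dom_eq[OF Z, of "f \<cdot> z"] z f Z by simp
  have mono: "mono_arrow C z" using zero_object_mono Z z .
  have "is_kernel C z f \<longleftrightarrow> mono_arrow C f"
  proof
    assume k: "is_kernel C z f"
    show "mono_arrow C f"
    proof (rule mono_arrowI[OF f(1)])
      fix h assume h: "h \<in> Arr C" "Cod C h = Dom C f" "f \<cdot> h = Zero C (Dom C h) (Cod C f)"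
      then obtain u where u: "u \<in> Arr C" "Dom C u = Dom C h" "Cod C u = Dom C z" "z \<cdot> u = h"
        using kernel_lift[OF k] by metis
      then show "h = Zero C (Dom C h) (Dom C f)" using z f z0 Z Zero_Comp[of u "Dom C f" Z] by simp
    qed
  next
    assume m: "mono_arrow C f"
    show "is_kernel C z f"
    proof (rule is_kernelI[OF mono f(1) f(2) fz])
      fix h assume h: "h \<in> Arr C" "Cod C h = Dom C f" "f \<cdot> h = Zero C (Dom C h) (Cod C f)"
      then have "h = Zero C (Dom C h) (Dom C f)"
        using mono_arrow_cancel[OF m, of h "Zero C (Dom C h) (Dom C f)"] f by simp
      moreover have "z \<cdot> Zero C (Dom C h) Z = Zero C (Dom C h) (Dom C f)" using h z f Z by simp
      ultimately show "\<exists>u. u \<in> Arr C \<and> Dom C u = Dom C h \<and> Cod C u = Dom C z \<and> z \<cdot> u = h"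
        using h z Z by (intro exI[of _ "Zero C (Dom C h) Z"]) simp
    qed
  qed
  then show ?thesis using exact_at_mono_iff[OF mono] by simp
qed

lemma exact_at_to_zero_iff:
  assumes "zero_object C Z" "z \<in> Arr C" "Cod C z = Z" "f \<in> Arr C" "Cod C f = Dom C z"
  shows "exact_at C f z \<longleftrightarrow> epi_arrow C f"
  using abelian_category.exact_at_from_zero_iff[OF abelian_opposite, of Z z f] assms by simp

text \<open>This eliminates the auxiliary arrows from and to zero objects: exactness next to them
  amounts to monicity at the start and epicity at the end.\<close>

lemma exact_seq_iff:
  "exact_seq C fs \<longleftrightarrow>
    fs \<noteq> [] \<and> mono_arrow C (hd fs) \<and> epi_arrow C (last fs) \<and> successively (exact_at C) fs"
proof (cases "fs = []")
  case False
  have ends: "successively (exact_at C) (z # fs @ [z']) \<longleftrightarrow>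
      exact_at C z (hd fs) \<and> exact_at C (last fs) z' \<and> successively (exact_at C) fs" for z z'
    using False by (auto simp: successively_Cons successively_append_iff)
  obtain Z where Z: "zero_object C Z" using zero_object_exists by blast
  show ?thesis
  proof
    assume "exact_seq C fs"
    then obtain z z' where z: "zero_object C (Dom C z)" "zero_object C (Cod C z')"
      "exact_at C z (hd fs)" "exact_at C (last fs) z'" "successively (exact_at C) fs"
      unfolding exact_seq_def ends by blast
    then show "fs \<noteq> [] \<and> mono_arrow C (hd fs) \<and> epi_arrow C (last fs) \<and> successively (exact_at C) fs"
      using False exact_at_from_zero_iff[OF z(1), of z "hd fs"] exact_at_to_zero_iff[OF z(2), of z' "last fs"]
      unfolding exact_at_def by blast
  next
    assume fs: "fs \<noteq> [] \<and> mono_arrow C (hd fs) \<and> epi_arrow C (last fs) \<and> successively (exact_at C) fs"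
    then have "exact_at C (Zero C Z (Dom C (hd fs))) (hd fs)"
      "exact_at C (last fs) (Zero C (Cod C (last fs)) Z)"
      using Z by (simp_all add: exact_at_from_zero_iff[OF Z] exact_at_to_zero_iff[OF Z])
    moreover have "zero_object C (Dom C (Zero C Z (Dom C (hd fs))))"
      "zero_object C (Cod C (Zero C (Cod C (last fs)) Z))" using Z fs by simp_all
    ultimately show "exact_seq C fs" unfolding exact_seq_def ends using fs by blast
  qed
qed (simp add: exact_seq_def)

lemma exact_seq_opposite: "exact_seq (opposite C) (rev fs) \<longleftrightarrow> exact_seq C fs"
proof -
  have "successively (exact_at (opposite C)) (rev fs) \<longleftrightarrow> successively (exact_at C) fs"
    by (simp add: successively_rev)
  then show ?thesis
    using abelian_category.exact_seq_iff[OF abelian_opposite, of "rev fs"] exact_seq_iff[of fs]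
    by (auto simp: hd_rev last_rev)
qed

text \<open>Between a monomorphism and an epimorphism, exactness in the middle is both the kernel
  and the cokernel condition. Lists of two arrows can be avoided from here on.\<close>

lemma short_exact_iff [simp]: "short_exact C f g \<longleftrightarrow> ses C f g"
proof -
  have "short_exact C f g \<longleftrightarrow> mono_arrow C f \<and> epi_arrow C g \<and> exact_at C f g"
    unfolding short_exact_def exact_seq_iff by auto
  then show ?thesis
    using exact_at_mono_iff[of f g] exact_at_epi_iff[of g f] sesD[of f g] unfolding ses_def by blast
qed

section \<open>Splicing exact sequences\<close>

lemma epi_comp_iff:
  assumes c: "epi_arrow C c" and m: "m \<in> Arr C" "Cod C c = Dom C m"
  shows "epi_arrow C (m \<cdot> c) \<longleftrightarrow> epi_arrow C m"
proof -
  have h: "h \<cdot> (m \<cdot> c) = Zero C (Dom C c) (Cod C h) \<longleftrightarrow> h \<cdot> m = Zero C (Dom C m) (Cod C h)"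
    if "h \<in> Arr C" "Dom C h = Cod C m" for h
    using that c m epi_arrow_cancel[OF c, of "h \<cdot> m" "Zero C (Dom C m) (Cod C h)"]
    by (auto simp: Arr_Comp_assoc[symmetric])
  have iff: "epi_arrow C e \<longleftrightarrow> (\<forall>h\<in>Arr C. Dom C h = Cod C e \<longrightarrow> h \<cdot> e = Zero C (Dom C e) (Cod C h) \<longrightarrow>
      h = Zero C (Cod C e) (Cod C h))" if "e \<in> Arr C" for e
  proof
    assume e: "epi_arrow C e"
    show "\<forall>h\<in>Arr C. Dom C h = Cod C e \<longrightarrow> h \<cdot> e = Zero C (Dom C e) (Cod C h) \<longrightarrow>
      h = Zero C (Cod C e) (Cod C h)"
      using that epi_arrow_cancel[OF e] by auto
  qed (use that in \<open>auto intro: epi_arrowI\<close>)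
  show ?thesis using c m h by (simp add: iff)
qed

lemma cokernel_comp_iff:
  assumes c: "epi_arrow C c" and m: "m \<in> Arr C" "Cod C c = Dom C m"
  shows "is_cokernel C q (m \<cdot> c) \<longleftrightarrow> is_cokernel C q m"
proof -
  have h: "h \<cdot> (m \<cdot> c) = Zero C (Dom C c) (Cod C h) \<longleftrightarrow> h \<cdot> m = Zero C (Dom C m) (Cod C h)"
    if "h \<in> Arr C" "Dom C h = Cod C m" for h
    using that c m epi_arrow_cancel[OF c, of "h \<cdot> m" "Zero C (Dom C m) (Cod C h)"]
    by (auto simp: Arr_Comp_assoc[symmetric])
  have h': "h \<cdot> (m \<cdot> c) = Zero C (Dom C c) Y \<longleftrightarrow> h \<cdot> m = Zero C (Dom C m) Y"
    if "h \<in> Hom C (Cod C m) Y" for h Y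
    using h[of h] that by (auto simp: Hom_def)
  show ?thesis unfolding is_cokernel_def using c m h h' by (auto cong: conj_cong)
qed

lemma kernel_comp:
  assumes "is_kernel C f c" and m: "mono_arrow C m" "Cod C c = Dom C m"
  shows "is_kernel C f (m \<cdot> c)"
proof -
  interpret opp: abelian_category "opposite C" by (rule abelian_opposite)
  show ?thesis using opp.cokernel_comp_iff[of m c f] assms is_kernelD[OF assms(1)] by simp
qed

text \<open>Base change stands in for choosing preimages. If \<open>m\<close> kills
  \<open>t\<close>, pull \<open>t\<close> back along the epimorphism \<open>c\<close> to
  \<open>t'\<close>. Then \<open>m \<cdot> c\<close> kills \<open>t'\<close>, so \<open>t'\<close>
  factors through \<open>f\<close> and \<open>c \<cdot> t'\<close> is zero. This composite is
  \<open>t \<cdot> e\<close> with \<open>e\<close> epi, so \<open>t\<close> is zero.\<close>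

lemma mono_of_kernel_comp:
  assumes c: "ses C f c" and m: "m \<in> Arr C" "Cod C c = Dom C m" and k: "is_kernel C f (m \<cdot> c)"
  shows "mono_arrow C m"
proof (rule mono_arrowI[OF m(1)])
  note cD = sesD[OF c]
  fix t assume t: "t \<in> Arr C" "Cod C t = Dom C m" "m \<cdot> t = Zero C (Dom C t) (Cod C m)"
  obtain k' e t' where pb: "ses C k' e" "Cod C e = Dom C t" "t' \<in> Arr C" "Dom C t' = Dom C e"
    "Cod C t' = Dom C c" "c \<cdot> t' = t \<cdot> e"
    using pullback_ses[OF c, of t] t m by metis
  note eD = sesD[OF pb(1)]
  have "(m \<cdot> c) \<cdot> t' = m \<cdot> (c \<cdot> t')" using cD(1-3) m pb(2-5) by (simp add: Arr_Comp_assoc)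
  also have "\<dots> = (m \<cdot> t) \<cdot> e" using m t(1,2) pb(2-6) eD(2) by (simp add: Arr_Comp_assoc)
  also have "\<dots> = Zero C (Dom C t') (Cod C m)" using m t pb eD by simp
  finally obtain u where u: "u \<in> Arr C" "Dom C u = Dom C t'" "Cod C u = Dom C f" "f \<cdot> u = t'"
    using kernel_lift[OF k, of t'] cD(1-3) m pb(2-5) by auto
  have "(c \<cdot> f) \<cdot> u = c \<cdot> (f \<cdot> u)" using u(1-3) cD(1-3) by (simp add: Arr_Comp_assoc)
  then have "t \<cdot> e = Zero C (Dom C t) (Cod C t) \<cdot> e" using u pb(2-6) t m cD eD by simp
  then show "t = Zero C (Dom C t) (Dom C m)" using epi_arrow_cancel[OF eD(6)] t m pb(2) by simp
qed

text \<open>The Yoneda splice at the left end, with \<open>Cod C c\<close> as the cosyzygy. The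
  equivalence serves both to take the first short exact sequence off and to put one on, which is how
  all inductions on length proceed.\<close>

lemma exact_seq_splice_iff:
  assumes c: "ses C f c" and m: "m \<in> Arr C" "Cod C c = Dom C m"
  shows "exact_seq C (f # m \<cdot> c # rest) \<longleftrightarrow> exact_seq C (m # rest)"
proof -
  note cD = sesD[OF c]
  have "exact_at C f (m \<cdot> c) \<longleftrightarrow> mono_arrow C m"
    using exact_at_mono_iff[OF cD(5)] kernel_comp[OF cD(7) _ m(2)] mono_of_kernel_comp[OF c m] by blast
  moreover have "exact_at C (m \<cdot> c) h \<longleftrightarrow> exact_at C m h" for h
    by (simp add: exact_at_iff cokernel_comp_iff[OF cD(6) m])
  moreover have "epi_arrow C (m \<cdot> c) \<longleftrightarrow> epi_arrow C m" using epi_comp_iff[OF cD(6) m] .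
  ultimately show ?thesis using cD(5) by (cases rest) (auto simp: exact_seq_iff)
qed

lemma exact_seq_factor:
  assumes "exact_seq C (f # g # rest)"
  obtains c m where "ses C f c" "m \<in> Arr C" "Cod C c = Dom C m" "Cod C m = Cod C g" "g = m \<cdot> c"
    "exact_seq C (m # rest)"
proof -
  have fg: "mono_arrow C f" "exact_at C f g" using assms by (auto simp: exact_seq_iff)
  then have k: "is_kernel C f g" using exact_at_mono_iff by blast
  obtain c where c: "ses C f c" using mono_ses fg by blast
  obtain m where m: "m \<in> Arr C" "Dom C m = Cod C c" "Cod C m = Cod C g" "m \<cdot> c = g"
    using cokernel_lift[OF sesD(8)[OF c], of g] is_kernelD[OF k] by auto
  have "exact_seq C (m # rest)"
    using exact_seq_splice_iff[OF c m(1) m(2)[symmetric], of rest] assms unfolding m(4) by blast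
  then show ?thesis using that[OF c m(1) m(2)[symmetric] m(3) m(4)[symmetric]] by blast
qed

end

section \<open>Yoneda extensions\<close>

text \<open>The working form of vanishing of Ext in degree one; the two are identified in
  \<open>Ext_vanishes_1_iff\<close>.\<close>

definition split_orthogonal :: "('o, 'a) additive_structure \<Rightarrow> 'o set \<Rightarrow> 'o set \<Rightarrow> bool" where
  "split_orthogonal C \<A> \<B> \<longleftrightarrow>
    (\<forall>f g. ses C f g \<and> Dom C f \<in> \<B> \<and> Cod C g \<in> \<A> \<longrightarrow> split C g)"

text \<open>
  Unlike \<open>extension_morphism\<close>, the components at the two ends are arbitrary, which the induction on
  the length of an extension needs.
\<close>

fun chain_map :: "('o, 'a) additive_structure \<Rightarrow> 'a list \<Rightarrow> 'a list \<Rightarrow> 'a list \<Rightarrow> bool" where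
  "chain_map C [] [] [h] \<longleftrightarrow> True"
| "chain_map C (f # fs) (g # gs) (h # h' # hs) \<longleftrightarrow>
    h \<in> Hom C (Dom C f) (Dom C g) \<and> h' \<cdot>\<^bsub>C\<^esub> f = g \<cdot>\<^bsub>C\<^esub> h \<and> chain_map C fs gs (h' # hs)"
| "chain_map C _ _ _ \<longleftrightarrow> False"

lemma chain_map_length: "chain_map C fs gs hs \<Longrightarrow> length hs = Suc (length fs)"
  by (induction C fs gs hs rule: chain_map.induct) auto

lemma chain_map_nth:
  "chain_map C fs gs hs \<Longrightarrow> j < length fs \<Longrightarrow>
    hs ! j \<in> Hom C (Dom C (fs ! j)) (Dom C (gs ! j)) \<and>
    hs ! Suc j \<cdot>\<^bsub>C\<^esub> fs ! j = gs ! j \<cdot>\<^bsub>C\<^esub> hs ! j"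
proof (induction C fs gs hs arbitrary: j rule: chain_map.induct)
  case (2 C f fs g gs h h' hs)
  then show ?case by (cases j) auto
qed auto

lemma chain_map_extension_morphism:
  assumes "chain_map C fs gs (Id C Y # hs)" "last hs = Id C X" "length fs = i + 1"
  shows "extension_morphism C i X Y fs gs (Id C Y # hs)"
  using chain_map_length[OF assms(1)] chain_map_nth[OF assms(1)] assms(2,3)
    last_conv_nth[of hs]
  unfolding extension_morphism_def by (cases "hs = []") auto

lemma rtrancl_symcl_sym:
  "(a, b) \<in> (R \<union> R\<inverse>)\<^sup>* \<Longrightarrow> (b, a) \<in> (R \<union> R\<inverse>)\<^sup>*"
  by (metis converse_Un converse_converse rtrancl_converseI sup_commute)

text \<open>The condition that some extension exists is explicit because the quotient of the empty
  set is empty. The rest says that a zigzag of morphisms joins any two extensions.\<close>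

lemma is_singleton_Ext_iff:
  "is_singleton (Ext C i X Y) \<longleftrightarrow> extensions C i X Y \<noteq> {} \<and>
    (\<forall>fs\<in>extensions C i X Y. \<forall>gs\<in>extensions C i X Y.
      (fs, gs) \<in> (extension_rel C i X Y \<union> (extension_rel C i X Y)\<inverse>)\<^sup>*)"
  (is "?L \<longleftrightarrow> ?E \<noteq> {} \<and> (\<forall>fs\<in>?E. \<forall>gs\<in>?E. (fs, gs) \<in> ?R)")
proof
  assume ?L
  then obtain c where c: "Ext C i X Y = {c}" by (auto simp: is_singleton_def)
  then have "?R `` {fs} = c" if "fs \<in> ?E" for fs
    using that unfolding Ext_def quotient_def by auto
  then have "(fs, gs) \<in> ?R" if "fs \<in> ?E" "gs \<in> ?E" for fs gs
    using that by (metis Image_singleton_iff rtrancl.rtrancl_refl)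
  moreover have "?E \<noteq> {}" using c unfolding Ext_def quotient_def by auto
  ultimately show "?E \<noteq> {} \<and> (\<forall>fs\<in>?E. \<forall>gs\<in>?E. (fs, gs) \<in> ?R)" by blast
next
  assume R: "?E \<noteq> {} \<and> (\<forall>fs\<in>?E. \<forall>gs\<in>?E. (fs, gs) \<in> ?R)"
  then obtain e where e: "e \<in> ?E" by blast
  have cls: "?R `` {fs} = ?R `` {e}" if "fs \<in> ?E" for fs
  proof -
    have "(fs, e) \<in> ?R" "(e, fs) \<in> ?R" using R e that by blast+
    then have "(fs, x) \<in> ?R \<longleftrightarrow> (e, x) \<in> ?R" for x by (meson rtrancl_trans)
    then show ?thesis unfolding set_eq_iff Image_singleton_iff by (intro allI)
  qed
  have "Ext C i X Y = (\<lambda>fs. ?R `` {fs}) ` ?E" unfolding Ext_def quotient_def by blast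
  also have "\<dots> = (\<lambda>fs. ?R `` {e}) ` ?E" by (rule image_cong[OF refl cls])
  also have "\<dots> = {?R `` {e}}" using e by (rule_tac image_constant)
  finally have "Ext C i X Y = {?R `` {e}}" .
  then show ?L by (simp add: is_singleton_def)
qed

context abelian_category
begin

lemma biproduct_ses:
  assumes bp: "is_biproduct C P X Y i j p q"
  shows "ses C i q"
proof (rule ses_epiI)
  note D = biproductD[OF bp]
  show "epi_arrow C q"
  proof (rule epi_arrowI[OF D(10)])
    fix h assume h: "h \<in> Arr C" "Dom C h = Cod C q" "h \<cdot> q = Zero C (Dom C q) (Cod C h)"
    have "h = (h \<cdot> q) \<cdot> j" using h(1,2) D by (simp add: Arr_Comp_assoc)
    then show "h = Zero C (Cod C q) (Cod C h)" using h D by simp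
  qed
  have mono: "mono_arrow C i"
  proof (rule mono_arrowI[OF D(1)])
    fix h assume h: "h \<in> Arr C" "Cod C h = Dom C i" "i \<cdot> h = Zero C (Dom C h) (Cod C i)"
    have "h = p \<cdot> (i \<cdot> h)" using h(1,2) D by (simp flip: Arr_Comp_assoc)
    then show "h = Zero C (Dom C h) (Dom C i)" using h D by simp
  qed
  show "is_kernel C i q"
  proof (rule is_kernelI[OF mono D(10)])
    fix h assume h: "h \<in> Arr C" "Cod C h = Dom C q" "q \<cdot> h = Zero C (Dom C h) (Cod C q)"
    have "i \<cdot> (p \<cdot> h) = h"
    proof (rule biproduct_projections_cancel[OF bp])
      have "p \<cdot> (i \<cdot> (p \<cdot> h)) = (p \<cdot> i) \<cdot> (p \<cdot> h)" using h(1,2) D(1-12) by (simp add: Arr_Comp_assoc)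
      then show "p \<cdot> (i \<cdot> (p \<cdot> h)) = p \<cdot> h" using h(1,2) D by simp
      have "q \<cdot> (i \<cdot> (p \<cdot> h)) = (q \<cdot> i) \<cdot> (p \<cdot> h)" using h(1,2) D(1-12) by (simp add: Arr_Comp_assoc)
      then show "q \<cdot> (i \<cdot> (p \<cdot> h)) = q \<cdot> h" using h D by simp
    qed (use h D in simp_all)
    then show "\<exists>u. u \<in> Arr C \<and> Dom C u = Dom C h \<and> Cod C u = Dom C i \<and> i \<cdot> u = h"
      using h D by (intro exI[of _ "p \<cdot> h"]) simp
  qed (use D in simp_all)
qed

section \<open>Connecting Yoneda extensions by chain maps\<close>

lemma extensions_one_iff:
  "fs \<in> extensions C 1 X Y \<longleftrightarrow> (\<exists>f g. fs = [f, g] \<and> ses C f g \<and> Dom C f = Y \<and> Cod C g = X)"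
  by (auto simp: extensions_def length_Suc_conv simp flip: short_exact_iff[unfolded short_exact_def])

text \<open>In degree \<open>k + 2\<close> there are \<open>k + 3\<close> arrows, so
  \<open>rest\<close> is nonempty. Factoring the second arrow thus leaves the last epimorphism, on
  which splitting is tested, untouched.\<close>

lemma extensions_Suc_Suc:
  assumes "fs \<in> extensions C (Suc (Suc k)) X Y"
  obtains f c m rest where "fs = f # m \<cdot> c # rest" "ses C f c" "m \<in> Arr C" "Cod C c = Dom C m"
    "Dom C f = Y" "m # rest \<in> extensions C (Suc k) X (Cod C c)" "rest \<noteq> []"
proof -
  obtain f g rest where fs: "fs = f # g # rest" and len: "length rest = Suc k"
    using assms unfolding extensions_def by (auto simp: length_Suc_conv)
  have "exact_seq C (f # g # rest)" using assms fs unfolding extensions_def by auto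
  then obtain c m where c: "ses C f c" "m \<in> Arr C" "Cod C c = Dom C m" "g = m \<cdot> c"
    "exact_seq C (m # rest)"
    by (rule exact_seq_factor)
  have rest: "rest \<noteq> []" using len by auto
  show ?thesis
    by (rule that[OF fs[unfolded c(4)] c(1-3) _ _ rest])
      (use assms fs len rest c(3,5) in \<open>simp_all add: extensions_def\<close>)
qed

lemma extensions_splice:
  assumes "ses C f c" "m # rest \<in> extensions C (Suc k) X (Cod C c)"
  shows "f # m \<cdot> c # rest \<in> extensions C (Suc (Suc k)) X (Dom C f)"
proof -
  have m: "m \<in> Arr C" "Dom C m = Cod C c" "rest \<noteq> []"
    using assms(2) by (auto simp: extensions_def exact_seq_iff)
  then show ?thesis
    using assms exact_seq_splice_iff[of f c m rest] by (auto simp: extensions_def)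
qed

text \<open>The witness is the trivial extension: a biproduct in degree one, and otherwise the
  identity of \<open>Y\<close> spliced with the trivial extension of \<open>X\<close> by a zero
  object. A map out of it is determined by \<open>u\<close> and a section of the last epimorphism of
  \<open>gs\<close>. The source of \<open>u\<close> varies because the tail starts at the zero
  object, and one \<open>ts\<close> serves all \<open>gs\<close> so that it can connect
  them.\<close>

lemma split_extension_chain_map:
  assumes "X \<in> Ob C" "Y \<in> Ob C"
  shows "\<exists>ts\<in>extensions C (Suc k) X Y. \<forall>Y' u gs.
    u \<in> Hom C Y Y' \<and> gs \<in> extensions C (Suc k) X Y' \<and> split C (last gs) \<longrightarrow>
    (\<exists>hs. chain_map C ts gs (u # hs) \<and> last hs = Id C X)"
  using assms(2)
proof (induction k arbitrary: Y)
  case 0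
  obtain P i j p q where bp: "is_biproduct C P Y X i j p q"
    using biproduct_exists assms(1) 0 by blast
  note D = biproductD[OF bp]
  have "[i, q] \<in> extensions C (Suc 0) X Y" using biproduct_ses[OF bp] D extensions_one_iff by auto
  moreover have "\<exists>hs. chain_map C [i, q] gs (u # hs) \<and> last hs = Id C X"
    if u: "u \<in> Hom C Y Y'" and gs: "gs \<in> extensions C (Suc 0) X Y'" "split C (last gs)" for Y' u gs
  proof -
    obtain f g where fg: "gs = [f, g]" "ses C f g" "Dom C f = Y'" "Cod C g = X"
      using gs extensions_one_iff[of gs X Y'] by auto
    note E = sesD[OF fg(2)]
    obtain s where s: "s \<in> Arr C" "Dom C s = X" "Cod C s = Dom C g" "g \<cdot> s = Id C X"
      using gs(2) fg by (auto simp: split_def Hom_def)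
    have u': "u \<in> Arr C" "Dom C u = Y" "Cod C u = Y'" using u by (auto simp: Hom_def)
    \<comment> \<open>The map out of the biproduct that is \<open>f \<cdot> u\<close> on the summand
      \<open>Y\<close> and the section \<open>s\<close> on the summand \<open>X\<close>.\<close>
    define h where "h = Add C (f \<cdot> u \<cdot> p) (s \<cdot> q)"
    have h: "h \<in> Hom C P (Dom C g)"
      using s(1-3) u' E(1-3) D(1-12) fg by (simp add: h_def Hom_def)
    have "h \<cdot> i = Add C (f \<cdot> u \<cdot> (p \<cdot> i)) (s \<cdot> (q \<cdot> i))"
      using s(1-3) u' E(1-3) D(1-12) fg by (simp add: h_def Arr_Add_Comp Arr_Comp_assoc)
    then have hi: "h \<cdot> i = f \<cdot> u" using s(1-3) u' E(1-3) D fg by simp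
    have "g \<cdot> h = Add C ((g \<cdot> f) \<cdot> (u \<cdot> p)) ((g \<cdot> s) \<cdot> q)"
      using s(1-3) u' E(1-3) D(1-12) fg by (simp add: h_def Arr_Comp_Add Arr_Comp_assoc)
    then have "g \<cdot> h = q" using s u' E D fg by simp
    then show ?thesis using h hi u' fg D
      by (intro exI[of _ "[h, Id C X]"]) (simp add: Hom_def)
  qed
  ultimately show ?case by blast
next
  case (Suc k)
  obtain Z where Z: "zero_object C Z" using zero_object_exists by blast
  obtain ts where ts: "ts \<in> extensions C (Suc k) X Z"
    and maps: "\<And>Y' u gs. \<lbrakk>u \<in> Hom C Z Y'; gs \<in> extensions C (Suc k) X Y'; split C (last gs)\<rbrakk> \<Longrightarrow>
      \<exists>hs. chain_map C ts gs (u # hs) \<and> last hs = Id C X"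
    using Suc.IH[of Z] Z by auto
  obtain t ts' where t: "ts = t # ts'" "t \<in> Arr C" "Dom C t = Z"
    using ts by (cases ts) (auto simp: extensions_def exact_seq_iff)
  have Y: "Y \<in> Ob C" by fact
  have "mono_arrow C (Id C Y)" by (rule mono_arrowI) (use Y in auto)
  moreover have z: "is_cokernel C (Zero C Y Z) (Id C Y)"
  proof (rule is_cokernelI)
    show "epi_arrow C (Zero C Y Z)"
      by (rule epi_arrowI) (use Y Z in \<open>auto intro: zero_object_Dom_eq\<close>)
    fix h assume "h \<in> Arr C" "Dom C h = Cod C (Id C Y)" "h \<cdot> Id C Y = Zero C (Dom C (Id C Y)) (Cod C h)"
    then show "\<exists>u. u \<in> Arr C \<and> Dom C u = Cod C (Zero C Y Z) \<and> Cod C u = Cod C h \<and> u \<cdot> Zero C Y Z = h"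
      using Y Z by (intro exI[of _ "Zero C Z (Cod C h)"]) simp
  qed (use Y Z in simp_all)
  ultimately have ses: "ses C (Id C Y) (Zero C Y Z)" by (rule ses_monoI)
  have "Id C Y # t \<cdot> Zero C Y Z # ts' \<in> extensions C (Suc (Suc k)) X Y"
    using extensions_splice[OF ses, of t ts' k X] ts t Y Z by simp
  moreover have "\<exists>hs. chain_map C (Id C Y # t \<cdot> Zero C Y Z # ts') gs (u # hs) \<and> last hs = Id C X"
    if u: "u \<in> Hom C Y Y'" and gs: "gs \<in> extensions C (Suc (Suc k)) X Y'" "split C (last gs)" for Y' u gs
  proof -
    have u': "u \<in> Arr C" "Dom C u = Y" "Cod C u = Y'" using u by (auto simp: Hom_def)
    obtain f c m rest where fs: "gs = f # m \<cdot> c # rest" "ses C f c" "m \<in> Arr C" "Cod C c = Dom C m"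
      "Dom C f = Y'" "m # rest \<in> extensions C (Suc k) X (Cod C c)" "rest \<noteq> []"
      using extensions_Suc_Suc[OF gs(1)] .
    note E = sesD[OF fs(2)]
    obtain hs where hs: "chain_map C ts (m # rest) (Zero C Z (Cod C c) # hs)" "last hs = Id C X"
      using maps[of "Zero C Z (Cod C c)" "Cod C c" "m # rest"] gs fs Z E by (auto simp: Hom_def)
    then obtain h hs' where h: "hs = h # hs'" "h \<cdot> t = m \<cdot> Zero C Z (Cod C c)"
      "chain_map C ts' rest (h # hs')"
      using t by (cases hs) auto
    \<comment> \<open>\<open>chain_map\<close> types a component only together with the arrow that
      follows it, so source and target of \<open>h\<close> come from the heads of \<open>ts'\<close>
      and \<open>rest\<close>.\<close>
    have h': "h \<in> Arr C" "Dom C h = Cod C t" "Cod C h = Dom C (hd rest)"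
    proof -
      obtain r rest' where r: "rest = r # rest'" using fs by (cases rest) auto
      obtain t' ts'' where t': "ts' = t' # ts''" using h r by (cases ts') auto
      have "Cod C t = Dom C t'" using ts t t' by (auto simp: extensions_def exact_seq_iff exact_at_def)
      moreover have "h \<in> Hom C (Dom C t') (Dom C r)" using h t' r by (cases hs') auto
      ultimately show "h \<in> Arr C" "Dom C h = Cod C t" "Cod C h = Dom C (hd rest)"
        using r by (auto simp: Hom_def)
    qed
    \<comment> \<open>Both ways around the second square are zero: one passes through the zero
      object, the other contains \<open>c \<cdot> f\<close>.\<close>
    have "h \<cdot> (t \<cdot> Zero C Y Z) = (h \<cdot> t) \<cdot> Zero C Y Z"
      using h' t Y Z by (simp add: Arr_Comp_assoc del: Comp_Zero Zero_Comp)
    also have "\<dots> = Zero C Y (Cod C m)" using h(2) t Y Z fs E by simp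
    also have "\<dots> = m \<cdot> ((c \<cdot> f) \<cdot> u)" using fs E u' Y by simp
    also have "\<dots> = (m \<cdot> c) \<cdot> (f \<cdot> u)" using fs(3-5) E(1-3) u' by (simp add: Arr_Comp_assoc)
    finally have "chain_map C (Id C Y # t \<cdot> Zero C Y Z # ts') gs (u # (f \<cdot> u) # hs)"
      using h h' fs(1,3-5) E(1-3) u' Y Z t by (simp add: Hom_def)
    then show ?thesis using hs by (intro exI[of _ "(f \<cdot> u) # hs"]) (simp add: h)
  qed
  ultimately show ?case by blast
qed

text \<open>Pushing out along \<open>u\<close> makes the first term an object of \<B>. In degree one
  the result is an extension of \<open>X\<close> by that object, which splits by orthogonality. In
  higher degree the middle term of the pushout is embedded into \<B>, which replaces the cosyzygy by
  one in \<B>, and the induced map of cosyzygies takes the role of \<open>u\<close> for the shorter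
  extension. Hence \<open>u\<close> and \<open>Y'\<close> vary in the induction.\<close>

lemma extension_push_split:
  assumes X: "X \<in> Ob C" and B: "\<B> \<subseteq> Ob C" and orth: "split_orthogonal C {X} \<B>"
    and emb: "\<And>Z. Z \<in> Ob C \<Longrightarrow> \<exists>f. mono_arrow C f \<and> Dom C f = Z \<and> Cod C f \<in> \<B>"
    and coker: "\<And>f g. \<lbrakk>ses C f g; Dom C f \<in> \<B>; Cod C f \<in> \<B>\<rbrakk> \<Longrightarrow> Cod C g \<in> \<B>"
    and fs: "fs \<in> extensions C (Suc k) X Y" and u: "u \<in> Hom C Y Y'" and Y': "Y' \<in> \<B>"
  shows "\<exists>gs\<in>extensions C (Suc k) X Y'. split C (last gs) \<and>
    (\<exists>hs. chain_map C fs gs (u # hs) \<and> last hs = Id C X)"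
  using fs u Y'
proof (induction k arbitrary: Y Y' fs u)
  case 0
  obtain f c where fs: "fs = [f, c]" "ses C f c" "Dom C f = Y" "Cod C c = X"
    using 0 extensions_one_iff[of fs X Y] by auto
  note D = sesD[OF fs(2)]
  have u: "u \<in> Arr C" "Dom C u = Y" "Cod C u = Y'" using 0 by (auto simp: Hom_def)
  obtain f' c' e where po: "ses C f' c'" "Cod C c' = Cod C c" "Dom C f' = Cod C u" "e \<in> Arr C"
    "Dom C e = Cod C f" "Cod C e = Cod C f'" "c' \<cdot> e = c" "e \<cdot> f = f' \<cdot> u"
    using pushout_ses[OF fs(2), of u] u fs by metis
  have "split C c'" using orth po fs u 0 unfolding split_orthogonal_def by auto
  moreover have "[f', c'] \<in> extensions C (Suc 0) X Y'" using extensions_one_iff po u fs by auto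
  moreover have "chain_map C fs [f', c'] [u, e, Id C X]"
    using fs u po D sesD(3)[OF po(1)] by (simp add: Hom_def)
  ultimately show ?case
    by (intro bexI[of _ "[f', c']"] conjI exI[of _ "[e, Id C X]"]) simp_all
next
  case (Suc k)
  obtain f c m rest where fs: "fs = f # m \<cdot> c # rest" "ses C f c" "m \<in> Arr C" "Cod C c = Dom C m"
    "Dom C f = Y" "m # rest \<in> extensions C (Suc k) X (Cod C c)" "rest \<noteq> []"
    using extensions_Suc_Suc[OF Suc.prems(1)] .
  note D = sesD[OF fs(2)]
  have u: "u \<in> Arr C" "Dom C u = Y" "Cod C u = Y'" using Suc.prems by (auto simp: Hom_def)
  obtain f' c' e where po: "ses C f' c'" "Cod C c' = Cod C c" "Dom C f' = Cod C u" "e \<in> Arr C"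
    "Dom C e = Cod C f" "Cod C e = Cod C f'" "c' \<cdot> e = c" "e \<cdot> f = f' \<cdot> u"
    using pushout_ses[OF fs(2), of u] u fs by metis
  note E = sesD[OF po(1)]
  \<comment> \<open>The pushout \<open>Cod C f'\<close> need not lie in \<B>. With its embedding
    \<open>n\<close>, both terms of \<open>n \<cdot> f'\<close> do, and so does the
    cokernel.\<close>
  obtain n where n: "mono_arrow C n" "Dom C n = Cod C f'" "Cod C n \<in> \<B>"
    using emb[of "Cod C f'"] E by auto
  have "mono_arrow C (n \<cdot> f')"
  proof (rule mono_arrowI)
    fix h assume h: "h \<in> Arr C" "Cod C h = Dom C (n \<cdot> f')"
      "(n \<cdot> f') \<cdot> h = Zero C (Dom C h) (Cod C (n \<cdot> f'))"
    then have "n \<cdot> (f' \<cdot> h) = n \<cdot> (f' \<cdot> Zero C (Dom C h) (Dom C f'))"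
      using n E by (simp add: Arr_Comp_assoc)
    then have "f' \<cdot> h = f' \<cdot> Zero C (Dom C h) (Dom C f')"
      using mono_arrow_cancel[OF n(1), of "f' \<cdot> h" "f' \<cdot> Zero C (Dom C h) (Dom C f')"] h n E by simp
    then show "h = Zero C (Dom C h) (Dom C (n \<cdot> f'))"
      using mono_arrow_cancel[OF E(5), of h "Zero C (Dom C h) (Dom C f')"] h n E by simp
  qed (use n E in simp)
  then obtain d where d: "ses C (n \<cdot> f') d" using mono_ses by blast
  note F = sesD[OF d]
  have B'': "Cod C d \<in> \<B>" using coker[OF d] n E po u Suc.prems by simp
  have dn: "d \<in> Arr C" "Dom C d = Cod C n" using F n E by simp_all
  have "(d \<cdot> n) \<cdot> f' = Zero C (Dom C f') (Cod C d)"
    using F(4) dn n E(1-3) by (simp add: Arr_Comp_assoc)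
  \<comment> \<open>The map from the old cosyzygy to the new one, with which the induction
    continues.\<close>
  then obtain v where v: "v \<in> Arr C" "Dom C v = Cod C c" "Cod C v = Cod C d" "v \<cdot> c' = d \<cdot> n"
    using cokernel_lift[OF E(8), of "d \<cdot> n"] dn n E po by auto
  obtain gs hs where gs: "gs \<in> extensions C (Suc k) X (Cod C d)" "split C (last gs)"
    and hs: "chain_map C (m # rest) gs (v # hs)" "last hs = Id C X"
    using Suc.IH[OF fs(6), of v "Cod C d"] v B'' by (auto simp: Hom_def)
  obtain m' rest' h hs' where g: "gs = m' # rest'" "hs = h # hs'"
    and h: "h \<cdot> m = m' \<cdot> v" "chain_map C rest rest' (h # hs')"
    using hs by (cases gs; cases hs) auto
  have m': "m' \<in> Arr C" "Dom C m' = Cod C d" "rest' \<noteq> []"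
    using gs g by (auto simp: extensions_def exact_seq_iff)
  have h': "h \<in> Arr C" "Dom C h = Cod C m" "Cod C h = Dom C (hd rest')" "Cod C m' = Dom C (hd rest')"
  proof -
    obtain r rest1 where r: "rest = r # rest1" using fs by (cases rest) auto
    obtain r' rest2 where r': "rest' = r' # rest2" using m' by (cases rest') auto
    have "Cod C m = Dom C r" "Cod C m' = Dom C r'"
      using fs(6) r gs g r' by (auto simp: extensions_def exact_seq_iff exact_at_def)
    moreover have "h \<in> Hom C (Dom C r) (Dom C r')" using h r r' by (cases hs') auto
    ultimately show "h \<in> Arr C" "Dom C h = Cod C m" "Cod C h = Dom C (hd rest')"
      "Cod C m' = Dom C (hd rest')"
      using r' by (auto simp: Hom_def)
  qed
  define gs' where "gs' = (n \<cdot> f') # m' \<cdot> d # rest'"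
  have "gs' \<in> extensions C (Suc (Suc k)) X Y'"
    using extensions_splice[OF d, of m' rest' k X] gs g n E po u by (simp add: gs'_def)
  moreover have "split C (last gs')" using gs g m' by (simp add: gs'_def)
  moreover have "chain_map C fs gs' (u # (n \<cdot> e) # hs)"
  proof -
    have "(n \<cdot> e) \<cdot> f = n \<cdot> (e \<cdot> f)" using n po(2-6) D by (simp add: Arr_Comp_assoc)
    also have "\<dots> = (n \<cdot> f') \<cdot> u" using n po u E by (simp add: Arr_Comp_assoc)
    finally have 1: "(n \<cdot> e) \<cdot> f = (n \<cdot> f') \<cdot> u" .
    have "h \<cdot> (m \<cdot> c) = (h \<cdot> m) \<cdot> c" using h' fs D(1-3) by (simp add: Arr_Comp_assoc)
    also have "\<dots> = m' \<cdot> (v \<cdot> (c' \<cdot> e))"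
      using h(1) m' v(1-3) po(7) D(1-3) by (simp add: Arr_Comp_assoc)
    also have "\<dots> = m' \<cdot> ((v \<cdot> c') \<cdot> e)" using v(1-3) po(2-6) E(1-3) by (simp add: Arr_Comp_assoc)
    also have "\<dots> = (m' \<cdot> d) \<cdot> (n \<cdot> e)" using v(4) m' dn n po(2-6) E(1-3) by (simp add: Arr_Comp_assoc)
    finally have 2: "h \<cdot> (m \<cdot> c) = (m' \<cdot> d) \<cdot> (n \<cdot> e)" .
    show ?thesis
      using 1 2 h(2) u n po(2-6) E(1-3) D(1-3) fs(1,3-5) dn m' by (simp add: g gs'_def Hom_def)
  qed
  ultimately show ?case using hs by (intro bexI[of _ gs'] conjI exI[of _ "(n \<cdot> e) # hs"]) (simp_all add: g)
qed

text \<open>Any extension maps to one whose last epimorphism splits, and the trivial extension maps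
  to that one too. So two steps, in opposite directions, join every extension to the trivial
  one.\<close>

lemma split_orthogonal_imp_Ext_singleton:
  assumes X: "X \<in> Ob C" and B: "\<B> \<subseteq> Ob C" and orth: "split_orthogonal C {X} \<B>"
    and emb: "\<And>Z. Z \<in> Ob C \<Longrightarrow> \<exists>f. mono_arrow C f \<and> Dom C f = Z \<and> Cod C f \<in> \<B>"
    and coker: "\<And>f g. \<lbrakk>ses C f g; Dom C f \<in> \<B>; Cod C f \<in> \<B>\<rbrakk> \<Longrightarrow> Cod C g \<in> \<B>"
    and Y: "Y \<in> \<B>"
  shows "is_singleton (Ext C (Suc k) X Y)"
proof -
  let ?E = "extensions C (Suc k) X Y" and ?R = "extension_rel C (Suc k) X Y"
  have Id: "Id C Y \<in> Hom C Y Y" using Y B by (auto simp: Id_in_Hom)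
  have rel: "(fs, gs) \<in> ?R"
    if "fs \<in> ?E" "gs \<in> ?E" "chain_map C fs gs (Id C Y # hs)" "last hs = Id C X" for fs gs hs
    using that chain_map_extension_morphism[of C fs gs Y hs X "Suc k"]
    by (auto simp: extension_rel_def extensions_def)
  have "Y \<in> Ob C" using Y B by blast
  then obtain ts where ts: "ts \<in> ?E"
    and maps: "\<And>gs. \<lbrakk>gs \<in> ?E; split C (last gs)\<rbrakk> \<Longrightarrow> \<exists>hs. chain_map C ts gs (Id C Y # hs) \<and> last hs = Id C X"
    using split_extension_chain_map[OF X, of Y k] Id by blast
  have conn: "(fs, ts) \<in> (?R \<union> ?R\<inverse>)\<^sup>*" if fs: "fs \<in> ?E" for fs
  proof -
    have "\<exists>gs\<in>?E. split C (last gs) \<and> (\<exists>hs. chain_map C fs gs (Id C Y # hs) \<and> last hs = Id C X)"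
      by (rule extension_push_split[OF X B orth _ _ fs Id Y]) (use emb coker in blast)+
    then obtain gs hs where gs: "gs \<in> ?E" "split C (last gs)" "chain_map C fs gs (Id C Y # hs)"
      "last hs = Id C X" by blast
    have "(fs, gs) \<in> ?R" using rel fs gs by blast
    moreover have "(ts, gs) \<in> ?R" using rel ts gs maps by blast
    ultimately have "(fs, gs) \<in> ?R \<union> ?R\<inverse>" "(gs, ts) \<in> ?R \<union> ?R\<inverse>" by auto
    then show ?thesis by (rule r_into_rtrancl[THEN rtrancl.rtrancl_into_rtrancl])
  qed
  have "(fs, gs) \<in> (?R \<union> ?R\<inverse>)\<^sup>*" if "fs \<in> ?E" "gs \<in> ?E" for fs gs
    using conn[OF that(1)] rtrancl_symcl_sym[OF conn[OF that(2)]] by (rule rtrancl_trans)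
  then show ?thesis using ts is_singleton_Ext_iff[of C "Suc k" X Y] by blast
qed

text \<open>The middle component carries a section forwards by composition after it, and a
  retraction backwards by composition before it. This makes splitting invariant without the five
  lemma, which would show the middle component invertible.\<close>

lemma extension_rel_one_split_iff:
  assumes "(fs, gs) \<in> extension_rel C 1 X Y"
  shows "split C (last fs) \<longleftrightarrow> split C (last gs)"
proof -
  obtain hs where fs: "fs \<in> extensions C 1 X Y" and gs: "gs \<in> extensions C 1 X Y"
    and hs: "extension_morphism C 1 X Y fs gs hs"
    using assms by (auto simp: extension_rel_def)
  obtain f g where f: "fs = [f, g]" "ses C f g" "Dom C f = Y" "Cod C g = X"
    using fs extensions_one_iff by auto
  obtain f' g' where f': "gs = [f', g']" "ses C f' g'" "Dom C f' = Y" "Cod C g' = X"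
    using gs extensions_one_iff by auto
  note D = sesD[OF f(2)] and D' = sesD[OF f'(2)]
  have "length hs = 3" using hs by (simp add: extension_morphism_def)
  then obtain a h b where abh: "hs = [a, h, b]"
    by (auto simp: length_Suc_conv numeral_3_eq_3)
  have a: "a = Id C Y" "b = Id C X"
    using hs unfolding extension_morphism_def abh by simp_all
  have step: "\<And>j. j \<le> 1 \<Longrightarrow>
      hs ! j \<in> Hom C (Dom C (fs ! j)) (Dom C (gs ! j)) \<and> hs ! (j + 1) \<cdot> fs ! j = gs ! j \<cdot> hs ! j"
    using hs unfolding extension_morphism_def by blast
  have 1: "h \<cdot> f = f' \<cdot> a"
    using step[of 0] unfolding abh f(1) f'(1) by simp
  have 2: "b \<cdot> g = g' \<cdot> h" "h \<in> Hom C (Dom C g) (Dom C g')"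
    using step[of 1] unfolding abh f(1) f'(1) by simp_all
  have h: "h \<in> Arr C" "Dom C h = Dom C g" "Cod C h = Dom C g'"
    using 2(2) by (simp_all add: Hom_def)
  have hf: "h \<cdot> f = f'" using 1 Comp_Id_Dom[OF D'(1) f'(3)] unfolding a by simp
  have gh: "g' \<cdot> h = g" using 2(1) Id_Cod_Comp[OF D(2) f(4)] unfolding a by simp
  show ?thesis
  proof
    assume "split C (last fs)"
    then obtain s where s: "s \<in> Arr C" "Dom C s = X" "Cod C s = Dom C g" "g \<cdot> s = Id C X"
      using f by (auto simp: split_def Hom_def)
    have "g' \<cdot> (h \<cdot> s) = (g' \<cdot> h) \<cdot> s" using s(1-3) h D' by (simp add: Arr_Comp_assoc)
    also have "\<dots> = Id C X" using gh s(4) by simp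
    finally show "split C (last gs)" unfolding split_def f'
      using s(1-3) h f' D' by (intro bexI[of _ "h \<cdot> s"]) (simp_all add: Hom_def)
  next
    assume "split C (last gs)"
    then obtain r where r: "r \<in> Arr C" "Dom C r = Cod C f'" "Cod C r = Dom C f'" "r \<cdot> f' = Id C (Dom C f')"
      using split_retraction[OF f'(2)] f' by auto
    have "(r \<cdot> h) \<cdot> f = r \<cdot> (h \<cdot> f)" using r(1-3) h D(1-3) D'(1-3) by (simp add: Arr_Comp_assoc)
    also have "\<dots> = Id C (Dom C f)" using hf r(4) f(3) f'(3) by simp
    finally have "(r \<cdot> h) \<cdot> f = Id C (Dom C f)" .
    moreover have "r \<cdot> h \<in> Hom C (Cod C f) (Dom C f)"
      using r(1-3) h D(1-3) D'(1-3) f(3) f'(3) by (simp add: Hom_def)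
    ultimately have "split C g" using retraction_split[OF f(2)] by blast
    then show "split C (last fs)" by (simp add: f(1))
  qed
qed

text \<open>The biproduct extension splits, and splitting spreads along zigzags to all extensions.
  Conversely, if all of them split, the trivial one maps to each.\<close>

lemma Ext_1_singleton_iff:
  assumes X: "X \<in> Ob C" and Y: "Y \<in> Ob C"
  shows "is_singleton (Ext C 1 X Y) \<longleftrightarrow> split_orthogonal C {X} {Y}"
proof
  let ?E = "extensions C 1 X Y" and ?R = "extension_rel C 1 X Y"
  assume "is_singleton (Ext C 1 X Y)"
  then have conn: "\<And>fs gs. \<lbrakk>fs \<in> ?E; gs \<in> ?E\<rbrakk> \<Longrightarrow> (fs, gs) \<in> (?R \<union> ?R\<inverse>)\<^sup>*"
    unfolding is_singleton_Ext_iff by blast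
  obtain P i j p q where bp: "is_biproduct C P Y X i j p q" using biproduct_exists X Y by blast
  note D = biproductD[OF bp]
  have iq: "[i, q] \<in> ?E" using biproduct_ses[OF bp] D extensions_one_iff by auto
  have q: "split C q" unfolding split_def using D by (intro bexI[of _ j]) (simp_all add: Hom_def)
  have conn_split: "split C (last gs)" if "([i, q], gs) \<in> (?R \<union> ?R\<inverse>)\<^sup>*" for gs
    using that
  proof (induction rule: rtrancl_induct)
    case base
    then show ?case using q by simp
  next
    case (step fs gs)
    then consider "(fs, gs) \<in> ?R" | "(gs, fs) \<in> ?R" by blast
    then show ?case using extension_rel_one_split_iff step.IH by cases blast+
  qed
  have "split C g" if "ses C f g" "Dom C f = Y" "Cod C g = X" for f g
  proof -
    have "[f, g] \<in> ?E" using that extensions_one_iff by blast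
    then show ?thesis using conn[OF iq] conn_split[of "[f, g]"] by simp
  qed
  then show "split_orthogonal C {X} {Y}" unfolding split_orthogonal_def by blast
next
  let ?E = "extensions C 1 X Y" and ?R = "extension_rel C 1 X Y"
  assume orth: "split_orthogonal C {X} {Y}"
  obtain ts where ts: "ts \<in> ?E" and maps: "\<And>gs. \<lbrakk>gs \<in> ?E; split C (last gs)\<rbrakk> \<Longrightarrow>
      \<exists>hs. chain_map C ts gs (Id C Y # hs) \<and> last hs = Id C X"
    using split_extension_chain_map[OF X Y, of 0] Id_in_Hom[OF Y] unfolding One_nat_def by blast
  have rel: "(ts, gs) \<in> ?R" if gs: "gs \<in> ?E" for gs
  proof -
    have "split C (last gs)" using gs orth extensions_one_iff by (auto simp: split_orthogonal_def)
    then show ?thesis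
      using maps[OF gs] ts gs chain_map_extension_morphism[of C ts gs Y _ X 1]
      by (auto simp: extension_rel_def extensions_def)
  qed
  have "(fs, gs) \<in> (?R \<union> ?R\<inverse>)\<^sup>*" if "fs \<in> ?E" "gs \<in> ?E" for fs gs
  proof -
    have "(fs, ts) \<in> ?R \<union> ?R\<inverse>" "(ts, gs) \<in> ?R \<union> ?R\<inverse>" using rel that by auto
    then show ?thesis by (rule r_into_rtrancl[THEN rtrancl.rtrancl_into_rtrancl])
  qed
  then show "is_singleton (Ext C 1 X Y)" using ts is_singleton_Ext_iff[of C 1 X Y] by blast
qed

lemma Ext_vanishes_1_iff:
  assumes "\<A> \<subseteq> Ob C" "\<B> \<subseteq> Ob C"
  shows "Ext_vanishes C 1 \<A> \<B> \<longleftrightarrow> split_orthogonal C \<A> \<B>"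
proof -
  have "Ext_vanishes C 1 \<A> \<B> \<longleftrightarrow> (\<forall>X\<in>\<A>. \<forall>Y\<in>\<B>. split_orthogonal C {X} {Y})"
    unfolding Ext_vanishes_def using assms Ext_1_singleton_iff by blast
  then show ?thesis by (auto simp: split_orthogonal_def)
qed

lemma split_orthogonal_opposite:
  "split_orthogonal (opposite C) \<B> \<A> \<longleftrightarrow> split_orthogonal C \<A> \<B>"
  unfolding split_orthogonal_def using split_opposite by auto

end

section \<open>Cotorsion pairs\<close>

context abelian_category
begin

text \<open>Base change of \<open>p\<close> along \<open>u\<close> has its kernel in \<B> and ends
  in \<A>, so it splits. A section followed by the projection to \<open>Dom C p\<close> is the lift.
  This replaces the exact sequence of Hom and Ext.\<close>

lemma orthogonal_lift:
  assumes orth: "split_orthogonal C \<A> \<B>" and kp: "ses C k p" "Dom C k \<in> \<B>"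
    and u: "u \<in> Arr C" "Dom C u \<in> \<A>" "Cod C u = Cod C p"
  obtains w where "w \<in> Arr C" "Dom C w = Dom C u" "Cod C w = Dom C p" "p \<cdot> w = u"
proof -
  note D = sesD[OF kp(1)]
  obtain k' p' u' where pb: "ses C k' p'" "Dom C k' = Dom C k" "Cod C p' = Dom C u"
    "u' \<in> Arr C" "Dom C u' = Dom C p'" "Cod C u' = Dom C p" "p \<cdot> u' = u \<cdot> p'"
    using pullback_ses[OF kp(1) u(1,3)] by metis
  note E = sesD[OF pb(1)]
  have "split C p'" using orth pb(1-3) kp(2) u(2) unfolding split_orthogonal_def by metis
  then obtain s where s: "s \<in> Arr C" "Dom C s = Dom C u" "Cod C s = Dom C p'" "p' \<cdot> s = Id C (Dom C u)"
    unfolding split_def pb(3) by (auto simp: Hom_def)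
  have "p \<cdot> (u' \<cdot> s) = (p \<cdot> u') \<cdot> s" using s(1-3) pb(4-6) D(2) by (simp add: Arr_Comp_assoc)
  also have "\<dots> = u \<cdot> (p' \<cdot> s)" using s(1-3) pb(3,7) u(1) E(2) by (simp add: Arr_Comp_assoc)
  also have "\<dots> = u" using s(4) u(1) by simp
  finally show ?thesis using that[of "u' \<cdot> s"] s(1-3) pb(4-6) by simp
qed

lemma orthogonal_extend:
  assumes "split_orthogonal C \<A> \<B>" "ses C k p" "Cod C p \<in> \<A>"
    "u \<in> Arr C" "Cod C u \<in> \<B>" "Dom C u = Dom C k"
  obtains w where "w \<in> Arr C" "Dom C w = Cod C k" "Cod C w = Cod C u" "w \<cdot> k = u"
  using abelian_category.orthogonal_lift[OF abelian_opposite, of \<B> \<A> p k u] assms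
  by (simp add: split_orthogonal_opposite) metis

lemma complete_cotorsion_pair_iff:
  assumes "\<A> \<subseteq> Ob C" "\<B> \<subseteq> Ob C"
  shows "complete_cotorsion_pair C \<A> \<B> \<longleftrightarrow>
    (\<forall>X\<in>Ob C. X \<in> \<A> \<longleftrightarrow> split_orthogonal C {X} \<B>) \<and>
    (\<forall>Y\<in>Ob C. Y \<in> \<B> \<longleftrightarrow> split_orthogonal C \<A> {Y}) \<and>
    (\<forall>X\<in>Ob C. \<exists>f g. ses C f g \<and> Cod C g = X \<and> Dom C g \<in> \<A> \<and> Dom C f \<in> \<B>) \<and>
    (\<forall>X\<in>Ob C. \<exists>f g. ses C f g \<and> Dom C f = X \<and> Cod C f \<in> \<B> \<and> Cod C g \<in> \<A>)"
proof -
  have "left_Ext1_orthogonal C \<B> = {X \<in> Ob C. split_orthogonal C {X} \<B>}"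
    unfolding left_Ext1_orthogonal_def using Ext_vanishes_1_iff[OF _ assms(2)] by auto
  moreover have "right_Ext1_orthogonal C \<A> = {Y \<in> Ob C. split_orthogonal C \<A> {Y}}"
    unfolding right_Ext1_orthogonal_def using Ext_vanishes_1_iff[OF assms(1)] by auto
  moreover have "\<A> = {X \<in> Ob C. P X} \<longleftrightarrow> (\<forall>X\<in>Ob C. X \<in> \<A> \<longleftrightarrow> P X)"
    "\<B> = {X \<in> Ob C. P X} \<longleftrightarrow> (\<forall>X\<in>Ob C. X \<in> \<B> \<longleftrightarrow> P X)" for P
    using assms by blast+
  ultimately show ?thesis unfolding complete_cotorsion_pair_def by simp
qed

section \<open>Duality for cotorsion pairs and resolving classes\<close>

lemma complete_cotorsion_pair_opposite:
  assumes "\<A> \<subseteq> Ob C" "\<B> \<subseteq> Ob C"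
  shows "complete_cotorsion_pair (opposite C) \<B> \<A> \<longleftrightarrow> complete_cotorsion_pair C \<A> \<B>"
proof -
  have "(\<exists>f g. ses C g f \<and> P g f) \<longleftrightarrow> (\<exists>f g. ses C f g \<and> P f g)" for P by blast
  then show ?thesis
    unfolding complete_cotorsion_pair_iff[OF assms]
      abelian_category.complete_cotorsion_pair_iff[OF abelian_opposite, unfolded opposite_simps, OF assms(2,1)]
    by (auto simp: split_orthogonal_opposite)
qed

lemma closed_under_extensions_opposite:
  "closed_under_extensions (opposite C) \<X> \<longleftrightarrow> closed_under_extensions C \<X>"
proof -
  have "closed_under_extensions (opposite C) \<X> \<longleftrightarrow>
    (\<forall>f g. ses C g f \<and> Cod C f \<in> \<X> \<and> Dom C g \<in> \<X> \<longrightarrow> Dom C f \<in> \<X>)"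
    unfolding closed_under_extensions_def
    by (simp add: abelian_category.short_exact_iff[OF abelian_opposite])
  also have "\<dots> \<longleftrightarrow> closed_under_extensions C \<X>"
    unfolding closed_under_extensions_def short_exact_iff using sesD(3) by metis
  finally show ?thesis .
qed

lemma coresolving_opposite: "coresolving (opposite C) \<X> \<longleftrightarrow> resolving C \<X>"
  unfolding coresolving_def resolving_def closed_under_extensions_opposite by auto

lemma hereditary_complete_cotorsion_pair_opposite:
  assumes "\<A> \<subseteq> Ob C" "\<B> \<subseteq> Ob C"
  shows "hereditary_complete_cotorsion_pair (opposite C) \<B> \<A> \<longleftrightarrow>
    hereditary_complete_cotorsion_pair C \<A> \<B>"
proof -
  have "resolving (opposite C) \<B> \<longleftrightarrow> coresolving C \<B>"
    using abelian_category.coresolving_opposite[OF abelian_opposite, of \<B>] by simp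
  then show ?thesis
    unfolding hereditary_complete_cotorsion_pair_def
    using complete_cotorsion_pair_opposite[OF assms] coresolving_opposite[of \<A>] by blast
qed

section \<open>Finite resolutions and summands\<close>

lemma coresolving_cokernel:
  assumes "coresolving C \<B>" "ses C f g" "Dom C f \<in> \<B>" "Cod C f \<in> \<B>"
  shows "Cod C g \<in> \<B>"
  using assms sesD[OF assms(2)] unfolding coresolving_def by blast

lemma coresolving_extension:
  assumes "coresolving C \<B>" "ses C f g" "Dom C f \<in> \<B>" "Cod C g \<in> \<B>"
  shows "Cod C f \<in> \<B>"
  using assms unfolding coresolving_def closed_under_extensions_def short_exact_iff by blast

text \<open>The two leftmost terms are replaced by the cokernel of the first arrow, again in \<B>,
  which shortens the resolution until one arrow remains.\<close>

lemma resolved_within_coresolving: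
  assumes co: "coresolving C \<B>"
  shows "resolved_within C \<B> m \<subseteq> \<B>"
proof -
  have "Cod C (last fs) \<in> \<B>" if "exact_seq C fs" "\<forall>f\<in>set fs. Dom C f \<in> \<B>" for fs
    using that
  proof (induction "length fs" arbitrary: fs rule: less_induct)
    case less
    obtain f rest where fs: "fs = f # rest" using less.prems by (cases fs) (auto simp: exact_seq_def)
    show ?case
    proof (cases rest)
      case Nil
      \<comment> \<open>The remaining arrow is an isomorphism, so its target is an extension of a
        zero object by its source. Zero objects are injective and thus in \<B>; closure under
        isomorphism comes out of closure under extensions.\<close>
      obtain Z where Z: "zero_object C Z" using zero_object_exists by blast
      have f: "mono_arrow C f" "epi_arrow C f" using less.prems fs Nil by (auto simp: exact_seq_iff)
      have "is_cokernel C (Zero C (Cod C f) Z) f"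
      proof (rule is_cokernelI)
        show "epi_arrow C (Zero C (Cod C f) Z)"
          by (rule epi_arrowI) (use f Z in \<open>auto intro: zero_object_Dom_eq\<close>)
        fix h assume h: "h \<in> Arr C" "Dom C h = Cod C f" "h \<cdot> f = Zero C (Dom C f) (Cod C h)"
        have "h = Zero C (Cod C f) (Cod C h)"
          using epi_arrow_cancel[OF f(2), of h "Zero C (Cod C f) (Cod C h)"] h f by simp
        moreover have "Zero C Z (Cod C h) \<cdot> Zero C (Cod C f) Z = Zero C (Cod C f) (Cod C h)"
          using h f Z by simp
        ultimately show "\<exists>u. u \<in> Arr C \<and> Dom C u = Cod C (Zero C (Cod C f) Z) \<and> Cod C u = Cod C h \<and>
            u \<cdot> Zero C (Cod C f) Z = h"
          using h f Z by (intro exI[of _ "Zero C Z (Cod C h)"]) simp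
      qed (use f Z in simp_all)
      then have "ses C f (Zero C (Cod C f) Z)" by (rule ses_monoI[OF f(1)])
      moreover have "injective C Z"
        unfolding injective_def
      proof (intro conjI allI impI ballI)
        fix m h assume m: "mono_arrow C m" and h: "h \<in> Hom C (Dom C m) Z"
        then show "\<exists>g\<in>Hom C (Cod C m) Z. g \<cdot> m = h"
          using Z by (intro bexI[of _ "Zero C (Cod C m) Z"])
            (auto simp: Hom_def intro: zero_object_Cod_eq)
      qed (use Z in simp)
      then have "Z \<in> \<B>" using co unfolding coresolving_def by blast
      ultimately show ?thesis
        using coresolving_extension[OF co, of f "Zero C (Cod C f) Z"] less.prems f Z fs Nil by simp
    next
      case (Cons g rest')
      have ex: "exact_seq C (f # g # rest')" using less.prems fs Cons by simp
      obtain c m where c: "ses C f c" "m \<in> Arr C" "Cod C c = Dom C m" "Cod C m = Cod C g" "g = m \<cdot> c"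
        "exact_seq C (m # rest')"
        using exact_seq_factor[OF ex] .
      have "Cod C f = Dom C g" using ex by (simp add: exact_seq_iff exact_at_def)
      then have "Dom C m \<in> \<B>" using coresolving_cokernel[OF co c(1)] c(3) less.prems fs Cons by simp
      then have "Cod C (last (m # rest')) \<in> \<B>"
        using less.hyps[of "m # rest'"] c(6) less.prems fs Cons by simp
      then show ?thesis using fs Cons c(4) by (auto split: if_splits)
    qed
  qed
  then show ?thesis unfolding resolved_within_def by blast
qed

text \<open>Passing to the opposite category reverses the diagrammatic order, so reversing lists
  matches the witnesses on the two sides.\<close>

lemma resolved_within_opposite: "resolved_within (opposite C) \<A> m = coresolved_within C \<A> m"
proof -
  have "(\<exists>fs. exact_seq (opposite C) fs \<and> length fs \<le> m + 1 \<and> Dom C (last fs) = X \<and>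
      (\<forall>f\<in>set fs. Cod C f \<in> \<A>)) \<longleftrightarrow>
    (\<exists>fs. exact_seq C fs \<and> length fs \<le> m + 1 \<and> Dom C (hd fs) = X \<and> (\<forall>f\<in>set fs. Cod C f \<in> \<A>))"
    (is "(\<exists>fs. ?P fs) \<longleftrightarrow> (\<exists>fs. ?Q fs)") for X
  proof -
    have PQ: "?P (rev fs) \<longleftrightarrow> ?Q fs" for fs
      by (simp only: exact_seq_opposite length_rev last_rev set_rev)
    show ?thesis
    proof
      assume "\<exists>fs. ?P fs"
      then obtain fs where "?P (rev (rev fs))" unfolding rev_rev_ident by blast
      then show "\<exists>fs. ?Q fs" unfolding PQ by blast
    next
      assume "\<exists>fs. ?Q fs"
      then show "\<exists>fs. ?P fs" unfolding PQ[symmetric] by blast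
    qed
  qed
  then show ?thesis unfolding resolved_within_def coresolved_within_def opposite_simps by blast
qed

lemma coresolved_within_resolving:
  "resolving C \<A> \<Longrightarrow> coresolved_within C \<A> m \<subseteq> \<A>"
  using abelian_category.resolved_within_coresolving[OF abelian_opposite, of \<A> m]
  by (simp add: coresolving_opposite resolved_within_opposite)

text \<open>The identity alone is an exact sequence with one arrow, that is, a resolution of length
  zero.\<close>

lemma subset_resolved_within:
  assumes "\<B> \<subseteq> Ob C" shows "\<B> \<subseteq> resolved_within C \<B> m"
proof
  fix X assume X: "X \<in> \<B>"
  then have Ob: "X \<in> Ob C" using assms by blast
  have "mono_arrow C (Id C X)" by (rule mono_arrowI) (use Ob in auto)
  moreover have "epi_arrow C (Id C X)" by (rule epi_arrowI) (use Ob in auto)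
  ultimately have "exact_seq C [Id C X]" by (simp add: exact_seq_iff)
  then show "X \<in> resolved_within C \<B> m"
    using X Ob unfolding resolved_within_def by (auto intro: exI[of _ "[Id C X]"])
qed

lemma subset_coresolved_within:
  "\<A> \<subseteq> Ob C \<Longrightarrow> \<A> \<subseteq> coresolved_within C \<A> m"
  using abelian_category.subset_resolved_within[OF abelian_opposite, of \<A> m]
  by (simp add: resolved_within_opposite)

text \<open>Lift the projection \<open>p\<close> along \<open>g\<close>; preceded by the injection
  \<open>i\<close>, the lift becomes a section of \<open>g\<close>.\<close>

lemma left_orthogonal_summands:
  assumes orth: "split_orthogonal C {P} \<B>" and bp: "is_biproduct C P X Y i j p q"
  shows "split_orthogonal C {X} \<B>"
  unfolding split_orthogonal_def
proof (intro allI impI)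
  note D = biproductD[OF bp]
  fix f g assume fg: "ses C f g \<and> Dom C f \<in> \<B> \<and> Cod C g \<in> {X}"
  then obtain w where w: "w \<in> Arr C" "Dom C w = P" "Cod C w = Dom C g" "g \<cdot> w = p"
    using orthogonal_lift[OF orth, of f g p] D by auto
  have "g \<cdot> (w \<cdot> i) = (g \<cdot> w) \<cdot> i" using w(1-3) D(1-3) sesD(2)[of f g] fg by (simp add: Arr_Comp_assoc)
  then have "g \<cdot> (w \<cdot> i) = Id C X" by (simp only: w(4) D(13))
  moreover have "w \<cdot> i \<in> Hom C X (Dom C g)" using w(1-3) D(1-3) by (simp add: Hom_def)
  moreover have "Cod C g = X" using fg by blast
  ultimately show "split C g" unfolding split_def by blast
qed

lemma complete_cotorsion_pair_summands:
  assumes "\<A> \<subseteq> Ob C" "\<B> \<subseteq> Ob C" "complete_cotorsion_pair C \<A> \<B>"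
  shows "closed_under_summands C \<A>"
  unfolding closed_under_summands_def
proof (intro ballI impI)
  fix P X Y assume P: "P \<in> \<A>" and X: "X \<in> Ob C" "\<exists>i j p q. is_biproduct C P X Y i j p q"
  have A: "\<forall>X\<in>Ob C. X \<in> \<A> \<longleftrightarrow> split_orthogonal C {X} \<B>"
    using assms(3) unfolding complete_cotorsion_pair_iff[OF assms(1,2)] by (elim conjE)
  then have "split_orthogonal C {P} \<B>" using P assms(1) by blast
  then show "X \<in> \<A>" using left_orthogonal_summands X A by blast
qed

text \<open>Hypotheses are phrased by splitting and approximations so that the lemma also applies in
  the opposite category, for a resolving \<A>. On the right only an embedding into \<B> is asked
  for, because its cokernel is corrected by means of left approximations.\<close>

lemma coresolving_imp_hereditary:
  assumes A: "\<A> \<subseteq> Ob C" "closed_under_summands C \<A>"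
    and B: "\<B> \<subseteq> Ob C" "closed_under_summands C \<B>"
    and orth: "split_orthogonal C \<A> \<B>"
    and left: "\<And>X. X \<in> Ob C \<Longrightarrow> \<exists>f g. ses C f g \<and> Cod C g = X \<and> Dom C g \<in> \<A> \<and> Dom C f \<in> \<B>"
    and emb: "\<And>X. X \<in> Ob C \<Longrightarrow> \<exists>f g. ses C f g \<and> Dom C f = X \<and> Cod C f \<in> \<B>"
    and co: "coresolving C \<B>"
  shows "hereditary_complete_cotorsion_pair C \<A> \<B>"
proof -
  have right: "\<exists>f g. ses C f g \<and> Dom C f = X \<and> Cod C f \<in> \<B> \<and> Cod C g \<in> \<A>" if X: "X \<in> Ob C" for X
  proof -
    obtain l b where lb: "ses C l b" "Dom C l = X" "Cod C l \<in> \<B>" using emb[OF X] by blast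
    obtain k a where ka: "ses C k a" "Cod C a = Cod C b" "Dom C a \<in> \<A>" "Dom C k \<in> \<B>"
      using left[of "Cod C b"] sesD(2)[OF lb(1)] by auto
    obtain k' a' l' b' where pb: "ses C k' a'" "Dom C k' = Dom C k" "Cod C a' = Dom C b"
      "ses C l' b'" "Dom C l' = Dom C l" "Cod C b' = Dom C a" "Cod C l' = Cod C k'"
      using pullback_two_ses[OF ka(1) lb(1) ka(2)] .
    \<comment> \<open>The common middle term is an extension of \<open>Cod C l\<close> by
      \<open>Dom C k\<close>, both in \<B>. Through \<open>l'\<close> it contains \<open>X\<close>,
      with quotient \<open>Dom C a\<close> in \<A>.\<close>
    have "Cod C k' \<in> \<B>"
      using coresolving_extension[OF co pb(1)] pb lb ka sesD(3)[OF lb(1)] by simp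
    then show ?thesis using pb lb ka by metis
  qed
  have left_orth: "X \<in> \<A> \<longleftrightarrow> split_orthogonal C {X} \<B>" if X: "X \<in> Ob C" for X
  proof
    assume "X \<in> \<A>"
    then show "split_orthogonal C {X} \<B>" using orth unfolding split_orthogonal_def by blast
  next
    assume X': "split_orthogonal C {X} \<B>"
    obtain f g where fg: "ses C f g" "Cod C g = X" "Dom C g \<in> \<A>" "Dom C f \<in> \<B>"
      using left X by blast
    then have "split C g" using X' unfolding split_orthogonal_def by blast
    then obtain s r where "is_biproduct C (Dom C g) (Dom C f) X f s r g"
      using split_biproduct[OF fg(1)] fg(2) unfolding split_def by metis
    \<comment> \<open>\<open>closed_under_summands\<close> speaks of the first summand only, so the
      summands are exchanged by commutativity of addition.\<close>
    then have "is_biproduct C (Dom C g) X (Dom C f) s f g r"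
      unfolding is_biproduct_def Hom_def using Arr_Add_commute[of "f \<cdot> r" "s \<cdot> g"] by auto
    then show "X \<in> \<A>" using A(2) fg X B(1) unfolding closed_under_summands_def by blast
  qed
  have right_orth: "Y \<in> \<B> \<longleftrightarrow> split_orthogonal C \<A> {Y}" if Y: "Y \<in> Ob C" for Y
  proof
    assume "Y \<in> \<B>"
    then show "split_orthogonal C \<A> {Y}" using orth unfolding split_orthogonal_def by blast
  next
    assume Y': "split_orthogonal C \<A> {Y}"
    obtain f g where fg: "ses C f g" "Dom C f = Y" "Cod C f \<in> \<B>" "Cod C g \<in> \<A>"
      using right Y by blast
    then have "split C g" using Y' unfolding split_orthogonal_def by blast
    then obtain s r where "is_biproduct C (Dom C g) Y (Cod C g) f s r g"
      using split_biproduct[OF fg(1)] fg(2) unfolding split_def by metis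
    moreover have "Dom C g \<in> \<B>" using fg sesD(3) by metis
    ultimately show "Y \<in> \<B>" using B(2) Y fg(4) A(1) unfolding closed_under_summands_def by blast
  qed
  \<comment> \<open>For \<open>k : B \<rightarrow> Z\<close> with cokernel \<open>p : Z \<rightarrow> X\<close>, embed \<open>m : Z \<rightarrow> B'\<close> and lift the induced map
    \<open>u : X \<rightarrow> B'/B\<close> to \<open>w : X \<rightarrow> B'\<close>; then \<open>m - w p\<close> factors as \<open>m k r\<close> with \<open>r\<close> a retraction of \<open>k\<close>.\<close>
  have crit: "X \<in> \<A>" if X: "X \<in> Ob C" and lift: "\<And>k p u. \<lbrakk>ses C k p; Dom C k \<in> \<B>; Cod C k \<in> \<B>;
    Cod C p \<in> \<B>; u \<in> Arr C; Dom C u = X; Cod C u = Cod C p\<rbrakk> \<Longrightarrow>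
    \<exists>w. w \<in> Arr C \<and> Dom C w = X \<and> Cod C w = Dom C p \<and> p \<cdot> w = u" for X
  proof -
    have "split C p" if kp: "ses C k p" "Dom C k \<in> \<B>" "Cod C p = X" for k p
    proof -
      note D = sesD[OF kp(1)]
      obtain m c where m: "ses C m c" "Dom C m = Cod C k" "Cod C m \<in> \<B>"
        using emb[of "Cod C k"] D by auto
      note E = sesD[OF m(1)]
      have mono: "mono_arrow C (m \<cdot> k)"
      proof (rule mono_arrowI)
        fix h assume h: "h \<in> Arr C" "Cod C h = Dom C (m \<cdot> k)" "(m \<cdot> k) \<cdot> h = Zero C (Dom C h) (Cod C (m \<cdot> k))"
        then have h': "Cod C h = Dom C k" using m D(1-3) E(1-3) by simp
        have "m \<cdot> (k \<cdot> h) = (m \<cdot> k) \<cdot> h"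
          using h(1) h' m D(1-3) E(1-3) by (simp add: Arr_Comp_assoc)
        also have "\<dots> = m \<cdot> (k \<cdot> Zero C (Dom C h) (Dom C k))" using h(1,3) h' m D(1-3) E(1-3) by simp
        finally have "k \<cdot> h = k \<cdot> Zero C (Dom C h) (Dom C k)"
          using mono_arrow_cancel[OF E(5), of "k \<cdot> h" "k \<cdot> Zero C (Dom C h) (Dom C k)"]
            h(1) h' m(2) D(1-3) by simp
        then have "h = Zero C (Dom C h) (Dom C k)"
          using mono_arrow_cancel[OF D(5), of h "Zero C (Dom C h) (Dom C k)"] h(1) h' D(1-3) by simp
        then show "h = Zero C (Dom C h) (Dom C (m \<cdot> k))" using m D(1-3) E(1-3) by simp
      qed (use m D E in simp)
      then obtain d where d: "ses C (m \<cdot> k) d" using mono_ses by blast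
      note F = sesD[OF d]
      have mk: "Dom C (m \<cdot> k) = Dom C k" "Cod C (m \<cdot> k) = Cod C m" using m D E by simp_all
      have d': "d \<in> Arr C" "Dom C d = Cod C m" "Cod C d \<in> \<B>"
        using F mk coresolving_cokernel[OF co d] kp m by simp_all
      have "(d \<cdot> m) \<cdot> k = d \<cdot> (m \<cdot> k)" using d' m D(1-3) E(1-3) by (simp add: Arr_Comp_assoc)
      then have "(d \<cdot> m) \<cdot> k = Zero C (Dom C k) (Cod C (d \<cdot> m))" using F(4) mk d' m D(1-3) E(1-3) by simp
      then obtain u where u: "u \<in> Arr C" "Dom C u = X" "Cod C u = Cod C d" "u \<cdot> p = d \<cdot> m"
        using cokernel_lift[OF D(8), of "d \<cdot> m"] d' m kp D(1-3) E(1-3) by auto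
      obtain w where w: "w \<in> Arr C" "Dom C w = X" "Cod C w = Cod C m" "d \<cdot> w = u"
        using lift[OF d, of u] mk kp m d' u by auto
      have "d \<cdot> (w \<cdot> p) = (d \<cdot> w) \<cdot> p" using w(1-3) d' kp D(2) by (simp add: Arr_Comp_assoc)
      then have dwp: "d \<cdot> (w \<cdot> p) = d \<cdot> m" using w(4) u(4) by simp
      define t where "t = Sub m (w \<cdot> p)"
      have t: "t \<in> Arr C" "Dom C t = Cod C k" "Cod C t = Cod C m"
        using w(1-3) m kp D(1-3) E(1-3) by (simp_all add: t_def)
      have "d \<cdot> t = Zero C (Dom C t) (Cod C d)"
        using w(1-3) m kp D(1-3) E(1-3) d' t dwp Sub_eq_Zero_iff[of "d \<cdot> m" "d \<cdot> m"]
        by (simp add: t_def Comp_Sub)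
      then obtain r where r: "r \<in> Arr C" "Dom C r = Cod C k" "Cod C r = Dom C k" "(m \<cdot> k) \<cdot> r = t"
        using kernel_lift[OF F(7), of t] t mk d' by auto
      have "t \<cdot> k = Sub (m \<cdot> k) (w \<cdot> (p \<cdot> k))"
        using w(1-3) m kp D(1-3) E(1-3) by (simp add: t_def Sub_Comp Arr_Comp_assoc)
      also have "\<dots> = m \<cdot> k" using w(1-3) m kp D(1-4) E(1-3) mk by simp
      finally have "((m \<cdot> k) \<cdot> r) \<cdot> k = (m \<cdot> k) \<cdot> Id C (Dom C k)" using r(4) m D(1-3) E(1-3) by simp
      then have "(m \<cdot> k) \<cdot> (r \<cdot> k) = (m \<cdot> k) \<cdot> Id C (Dom C k)"
        using Arr_Comp_assoc[of k r "m \<cdot> k"] r(1-3) m D(1-3) E(1-3) by simp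
      then have "r \<cdot> k = Id C (Dom C k)"
        using mono_arrow_cancel[OF mono, of "r \<cdot> k" "Id C (Dom C k)"] r(1-3) m D(1-3) E(1-3) by simp
      then show "split C p" using retraction_split[OF kp(1), of r] r by (simp add: Hom_def)
    qed
    then show ?thesis unfolding left_orth[OF X] split_orthogonal_def by blast
  qed
  have "resolving C \<A>"
    unfolding resolving_def
  proof (intro conjI allI impI)
    show "closed_under_extensions C \<A>"
      unfolding closed_under_extensions_def short_exact_iff
    proof (intro allI impI)
      fix f g assume fg: "ses C f g \<and> Dom C f \<in> \<A> \<and> Cod C g \<in> \<A>"
      then have ses: "ses C f g" by blast
      note D = sesD[OF ses]
      show "Cod C f \<in> \<A>"
      proof (rule crit)
        fix k p u assume kp: "ses C k p" and kB: "Dom C k \<in> \<B>" "Cod C k \<in> \<B>" "Cod C p \<in> \<B>"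
          and u: "u \<in> Arr C" "Dom C u = Cod C f" "Cod C u = Cod C p"
        note E = sesD[OF kp]
        \<comment> \<open>A lift on the subobject comes from \<open>Dom C f\<close> in \<A>. It then
          extends to the middle term because its target \<open>Cod C k\<close> is in \<B> and
          \<open>Cod C g\<close> is in \<A>.\<close>
        obtain v where v: "v \<in> Arr C" "Dom C v = Dom C f" "Cod C v = Dom C p" "p \<cdot> v = u \<cdot> f"
          using orthogonal_lift[OF orth kp kB(1), of "u \<cdot> f"] u D fg by auto
        obtain w where w: "w \<in> Arr C" "Dom C w = Cod C f" "Cod C w = Dom C p" "w \<cdot> f = v"
          using orthogonal_extend[OF orth ses, of v] v fg kB E by auto
        \<comment> \<open>The error of the extended lift vanishes on the subobject, hence descends
          to \<open>Cod C g\<close>, lifts from there, and corrects \<open>w\<close>.\<close>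
        define e where "e = Sub u (p \<cdot> w)"
        have e: "e \<in> Arr C" "Dom C e = Cod C f" "Cod C e = Cod C p"
          using u w(1-3) E(2) by (simp_all add: e_def)
        have "e \<cdot> f = Sub (u \<cdot> f) (p \<cdot> (w \<cdot> f))"
          using u w(1-3) E(2) D(1) by (simp add: e_def Sub_Comp Arr_Comp_assoc)
        then have "e \<cdot> f = Zero C (Dom C f) (Cod C e)"
          using v(4) w(4) u D(1) e Sub_eq_Zero_iff[of "u \<cdot> f" "u \<cdot> f"] by simp
        then obtain t where t: "t \<in> Arr C" "Dom C t = Cod C g" "Cod C t = Cod C p" "t \<cdot> g = e"
          using cokernel_lift[OF D(8), of e] e by auto
        obtain t' where t': "t' \<in> Arr C" "Dom C t' = Cod C g" "Cod C t' = Dom C p" "p \<cdot> t' = t"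
          using orthogonal_lift[OF orth kp kB(1), of t] t fg by auto
        have "p \<cdot> Add C w (t' \<cdot> g) = Add C (p \<cdot> w) ((p \<cdot> t') \<cdot> g)"
          using w(1-3) t'(1-3) D(1-3) E(2) by (simp add: Arr_Comp_Add Arr_Comp_assoc)
        also have "\<dots> = Add C (p \<cdot> w) e" using t'(4) t(4) by simp
        also have "\<dots> = u" unfolding e_def using u w(1-3) E(2) by (intro Add_Sub) simp_all
        finally show "\<exists>w. w \<in> Arr C \<and> Dom C w = Cod C f \<and> Cod C w = Dom C p \<and> p \<cdot> w = u"
          using w(1-3) t'(1-3) D(1-3) by (intro exI[of _ "Add C w (t' \<cdot> g)"]) simp
      qed (use D in simp)
    qed
  next
    fix e l assume el: "epi_arrow C e \<and> Dom C e \<in> \<A> \<and> Cod C e \<in> \<A> \<and> is_kernel C l e"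
    then have ses: "ses C l e" using ses_epiI by blast
    note D = sesD[OF ses]
    show "Dom C l \<in> \<A>"
    proof (rule crit)
      fix k p u assume kp: "ses C k p" and kB: "Dom C k \<in> \<B>" "Cod C k \<in> \<B>" "Cod C p \<in> \<B>"
        and u: "u \<in> Arr C" "Dom C u = Dom C l" "Cod C u = Cod C p"
      note E = sesD[OF kp]
      \<comment> \<open>Here it matters that the target \<open>Cod C p\<close> is in \<B>:
        \<open>u\<close> extends from the kernel to the middle term, since \<open>Cod C e\<close> is
        in \<A>. This step stands in for the dimension shift to degree two.\<close>
      obtain v where v: "v \<in> Arr C" "Dom C v = Cod C l" "Cod C v = Cod C p" "v \<cdot> l = u"
        using orthogonal_extend[OF orth ses, of u] u el kB by auto
      obtain w where w: "w \<in> Arr C" "Dom C w = Cod C l" "Cod C w = Dom C p" "p \<cdot> w = v"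
        using orthogonal_lift[OF orth kp kB(1), of v] v el D by auto
      have "p \<cdot> (w \<cdot> l) = (p \<cdot> w) \<cdot> l" using w(1-3) D(1) E(2) by (simp add: Arr_Comp_assoc)
      then show "\<exists>w. w \<in> Arr C \<and> Dom C w = Dom C l \<and> Cod C w = Dom C p \<and> p \<cdot> w = u"
        using w v(4) D(1) by (intro exI[of _ "w \<cdot> l"]) simp
    qed (use D in simp)
  next
    fix P assume P: "projective C P"
    then have Ob: "P \<in> Ob C" by (simp add: projective_def)
    have "split C g" if "ses C f g" "Cod C g = P" for f g
      using P that sesD(6)[OF that(1)] Id_in_Hom[OF Ob] unfolding projective_def split_def by blast
    then show "P \<in> \<A>" unfolding left_orth[OF Ob] split_orthogonal_def by blast
  qed
  then show ?thesis
    unfolding hereditary_complete_cotorsion_pair_def complete_cotorsion_pair_iff[OF A(1) B(1)]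
    using left_orth right_orth left right co by blast
qed

section \<open>Passing between n-cotorsion pairs and hereditary complete cotorsion pairs\<close>

lemma n_cotorsion_coresolving_imp_hereditary:
  assumes A: "\<A> \<subseteq> Ob C" and B: "\<B> \<subseteq> Ob C" and n: "n \<ge> 1"
    and nc: "n_cotorsion_pair C n \<A> \<B>" and co: "coresolving C \<B>"
  shows "hereditary_complete_cotorsion_pair C \<A> \<B>"
proof (rule coresolving_imp_hereditary[OF A _ B _ _ _ _ co])
  show "closed_under_summands C \<A>" "closed_under_summands C \<B>"
    using nc by (auto simp: n_cotorsion_pair_def left_n_cotorsion_pair_def right_n_cotorsion_pair_def)
  show "split_orthogonal C \<A> \<B>"
    using nc n Ext_vanishes_1_iff[OF A B] by (auto simp: n_cotorsion_pair_def left_n_cotorsion_pair_def)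
  fix X assume X: "X \<in> Ob C"
  \<comment> \<open>The kernel of the approximation has a resolution by \<B> of length at most
    \<open>n - 1\<close>, and this collapses into \<B>.\<close>
  show "\<exists>f g. ses C f g \<and> Cod C g = X \<and> Dom C g \<in> \<A> \<and> Dom C f \<in> \<B>"
    using nc X resolved_within_coresolving[OF co]
    unfolding n_cotorsion_pair_def left_n_cotorsion_pair_def short_exact_iff by blast
  show "\<exists>f g. ses C f g \<and> Dom C f = X \<and> Cod C f \<in> \<B>"
    using nc X unfolding n_cotorsion_pair_def right_n_cotorsion_pair_def short_exact_iff by blast
qed

text \<open>In the opposite category \<B> and \<A> exchange roles, and left and right approximations
  as well. Vanishing of Ext is turned into splitting before the passage.\<close>

lemma n_cotorsion_resolving_imp_hereditary:
  assumes A: "\<A> \<subseteq> Ob C" and B: "\<B> \<subseteq> Ob C" and n: "n \<ge> 1"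
    and nc: "n_cotorsion_pair C n \<A> \<B>" and re: "resolving C \<A>"
  shows "hereditary_complete_cotorsion_pair C \<A> \<B>"
proof -
  have "hereditary_complete_cotorsion_pair (opposite C) \<B> \<A>"
  proof (rule abelian_category.coresolving_imp_hereditary[OF abelian_opposite])
    show "closed_under_summands (opposite C) \<A>" "closed_under_summands (opposite C) \<B>"
      using nc by (auto simp: n_cotorsion_pair_def left_n_cotorsion_pair_def right_n_cotorsion_pair_def)
    show "split_orthogonal (opposite C) \<B> \<A>"
      using nc n Ext_vanishes_1_iff[OF A B]
      by (auto simp: n_cotorsion_pair_def left_n_cotorsion_pair_def split_orthogonal_opposite)
    show "coresolving (opposite C) \<A>" using re coresolving_opposite by blast
    fix X assume "X \<in> Ob (opposite C)"
    then have X: "X \<in> Ob C" by simp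
    show "\<exists>f g. ses (opposite C) f g \<and> Cod (opposite C) g = X \<and> Dom (opposite C) g \<in> \<B> \<and>
        Dom (opposite C) f \<in> \<A>"
      using nc X coresolved_within_resolving[OF re]
      unfolding n_cotorsion_pair_def right_n_cotorsion_pair_def short_exact_iff opposite_simps ses_opposite
      by blast
    show "\<exists>f g. ses (opposite C) f g \<and> Dom (opposite C) f = X \<and> Cod (opposite C) f \<in> \<A>"
      using nc X
      unfolding n_cotorsion_pair_def left_n_cotorsion_pair_def short_exact_iff opposite_simps ses_opposite
      by blast
  qed (use A B in simp_all)
  then show ?thesis using hereditary_complete_cotorsion_pair_opposite[OF A B] by simp
qed

text \<open>The approximations of the complete cotorsion pair are resolutions of length zero. Its
  right approximations also supply the embeddings into \<B> along which Yoneda extensions are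
  pushed, and this gives vanishing in every positive degree.\<close>

lemma hereditary_imp_n_cotorsion:
  assumes A: "\<A> \<subseteq> Ob C" and B: "\<B> \<subseteq> Ob C" and her: "hereditary_complete_cotorsion_pair C \<A> \<B>"
  shows "n_cotorsion_pair C n \<A> \<B>"
proof -
  have cc: "complete_cotorsion_pair C \<A> \<B>" and co: "coresolving C \<B>"
    using her by (simp_all add: hereditary_complete_cotorsion_pair_def)
  note iff = cc[unfolded complete_cotorsion_pair_iff[OF A B]]
  have sA: "closed_under_summands C \<A>" using complete_cotorsion_pair_summands[OF A B cc] .
  have sB: "closed_under_summands C \<B>"
    using abelian_category.complete_cotorsion_pair_summands[OF abelian_opposite, of \<B> \<A>]
      complete_cotorsion_pair_opposite[OF A B] A B cc by simp
  have Ext: "Ext_vanishes C i \<A> \<B>" if i: "1 \<le> i" for i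
    unfolding Ext_vanishes_def
  proof (intro ballI)
    fix X Y assume X: "X \<in> \<A>" and Y: "Y \<in> \<B>"
    obtain k where k: "i = Suc k" using i by (cases i) auto
    have Ob: "X \<in> Ob C" using X A by blast
    have orth: "split_orthogonal C {X} \<B>" using iff Ob X by blast
    have emb: "\<exists>f. mono_arrow C f \<and> Dom C f = Z \<and> Cod C f \<in> \<B>" if "Z \<in> Ob C" for Z
      using iff that sesD(5) by blast
    show "is_singleton (Ext C i X Y)"
      unfolding k using split_orthogonal_imp_Ext_singleton[OF Ob B orth emb coresolving_cokernel[OF co] Y] .
  qed
  have left: "\<forall>X\<in>Ob C. \<exists>f g. ses C f g \<and> Cod C g = X \<and> Dom C g \<in> \<A> \<and>
      Dom C f \<in> resolved_within C \<B> (n - 1)"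
    using iff subset_resolved_within[OF B, of "n - 1"] by blast
  have right: "\<forall>X\<in>Ob C. \<exists>f g. ses C f g \<and> Dom C f = X \<and> Cod C f \<in> \<B> \<and>
      Cod C g \<in> coresolved_within C \<A> (n - 1)"
    using iff subset_coresolved_within[OF A, of "n - 1"] by blast
  show ?thesis
    unfolding n_cotorsion_pair_def left_n_cotorsion_pair_def right_n_cotorsion_pair_def short_exact_iff
    using sA sB Ext left right by blast
qed

end

theorem proposition4p1:
  fixes C :: "('o, 'a) additive_structure" and \<A> \<B> :: "'o set" and n :: nat
  assumes "abelian_category C" and "\<A> \<subseteq> Ob C" and "\<B> \<subseteq> Ob C" and "n \<ge> 2"
  shows "((n_cotorsion_pair C n \<A> \<B> \<and> coresolving C \<B>) \<longleftrightarrow>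
            (n_cotorsion_pair C n \<A> \<B> \<and> resolving C \<A>)) \<and>
         ((n_cotorsion_pair C n \<A> \<B> \<and> coresolving C \<B>) \<longrightarrow>
            hereditary_complete_cotorsion_pair C \<A> \<B>) \<and>
         ((n_cotorsion_pair C n \<A> \<B> \<and> resolving C \<A>) \<longrightarrow>
            hereditary_complete_cotorsion_pair C \<A> \<B>) \<and>
         (enough_projectives C \<or> enough_injectives C \<longrightarrow>
            hereditary_complete_cotorsion_pair C \<A> \<B> \<longrightarrow>
              (n_cotorsion_pair C n \<A> \<B> \<and> coresolving C \<B>) \<and>
              (n_cotorsion_pair C n \<A> \<B> \<and> resolving C \<A>))"
proof -
  interpret abelian_category C by fact
  have n: "n \<ge> 1" using assms(4) by simp
  \<comment> \<open>The equivalence of (a) and (b) passes through (c), which contains both closure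
    properties.\<close>
  have "resolving C \<A>" "coresolving C \<B>" if "hereditary_complete_cotorsion_pair C \<A> \<B>"
    using that by (simp_all add: hereditary_complete_cotorsion_pair_def)
  then show ?thesis
    using n_cotorsion_coresolving_imp_hereditary[OF assms(2,3) n]
      n_cotorsion_resolving_imp_hereditary[OF assms(2,3) n]
      hereditary_imp_n_cotorsion[OF assms(2,3), of n]
    by blast
qed

end
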